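(* Let $\lambda\in\mathfrak h^*$ be such that $\lambda(\alpha_i^\vee)=n_i$ $(i=0,1)$ are nonnegative integers. Suppose that $c_1$ acts on $W(\lambda)$ as a scalar $k_1>0$ and that $c_2$ acts trivially (i.e. $\lambda(c_1)=k_1>0$, $\lambda(c_2)=0$). Then the $\mathfrak T$-module $W(\lambda)$ is not integrable.
   Context: All over $\mathbb C$. $\mathfrak{sl}_2$ has standard basis $e,f,\alpha^\vee$ with $[e,f]=\alpha^\vee$, $[\alpha^\vee,e]=2e$, $[\alpha^\vee,f]=-2f$ and invariant form with $(e|f)=1$, $(\alpha^\vee|\alpha^\vee)=2$. The toroidal Lie algebra is $\mathfrak T=\mathfrak{sl}_2\otimes\mathbb C[t_1^{\pm1},t_2^{\pm1}]\oplus\mathbb Cc_1\oplus\mathbb Cc_2\oplus\mathbb Cd_1\oplus\mathbb Cd_2$. Writing $x(m,n)=x\otimes t_1^mt_2^n$, the brackets are $[x(r_1,r_2),y(s_1,s_2)]=[x,y](r_1+s_1,r_2+s_2)+(x|y)\delta_{r_1,-s_1}\delta_{r_2,-s_2}(r_1c_1+r_2c_2)$, $c_1,c_2$ central, $[d_i,x(r_1,r_2)]=r_i\,x(r_1,r_2)$, $[d_1,d_2]=0$. Cartan subalgebra: $\mathfrak h=\mathbb C\alpha^\vee\oplus\mathbb Cc_1\oplus\mathbb Cc_2\oplus\mathbb Cd_1\oplus\mathbb Cd_2$ ($\alpha^\vee=\alpha^\vee(0,0)$). Coroots: $\alpha_1^\vee=\alpha^\vee$, $\alpha_0^\vee=c_1-\alpha^\vee$.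 Triangular decomposition $\mathfrak T=\mathfrak T_+\oplus\mathfrak h\oplus\mathfrak T_-$: $\mathfrak T_+$ is spanned by $e(m,0)$ $(m\ge 0)$, $f(m,0)$ and $\alpha^\vee(m,0)$ $(m\ge1)$, and all $x(m,n)$ with $x\in\mathfrak{sl}_2$, $m\in\mathbb Z$, $n\ge1$; $\mathfrak T_-$ is spanned by $f(-m,0)$ $(m\ge0)$, $e(-m,0)$ and $\alpha^\vee(-m,0)$ $(m\ge1)$, and all $x(m,-n)$ with $x\in\mathfrak{sl}_2$, $m\in\mathbb Z$, $n\ge1$. Verma module: $M(\lambda)=U(\mathfrak T)\otimes_{U(\mathfrak T_+\oplus\mathfrak h)}\mathbb C1_\lambda$, where $\mathfrak T_+$ acts by $0$ on $1_\lambda$ and $h\in\mathfrak h$ acts by $\lambda(h)$; $v_\lambda=1\otimes1_\lambda$. For $\lambda(\alpha_i^\vee)=n_i$ nonnegative integers, $W(\lambda)=M(\lambda)/\sum_{i=0}^1U(\mathfrak T_-)y_i^{n_i+1}v_\lambda$ with $y_1=f(0,0)$, $y_0=e(-1,0)$ (the subspace divided out is a submodule). A $\mathfrak T$-module is integrable if it is a weight module (direct sum of $\mathfrak h$-weight spaces) and all real root vectors $e(m,n)$, $f(m,n)$ $(m,n\in\mathbb Z)$ act locally nilpotently, i.e. for each such element $z$ and each vector $v$ there is $N$ with $z^Nv=0$. *)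

theory Defs
  imports Complex_Main "HOL-Library.Poly_Mapping" "HOL-Library.FuncSet" "HOL-Algebra.AbelCoset"
    "HOL-Algebra.Module"
begin

section \<open>Free complex vector spaces\<close>

text \<open>The free complex vector space on a type \<^typ>\<open>'a\<close> is \<^typ>\<open>'a \<Rightarrow>\<^sub>0 complex\<close>.\<close>

definition free_scale :: "complex \<Rightarrow> ('a \<Rightarrow>\<^sub>0 complex) \<Rightarrow> ('a \<Rightarrow>\<^sub>0 complex)" where
  "free_scale c = Poly_Mapping.map (\<lambda>z. c * z)"

lemma lookup_free_scale [simp]:
  "Poly_Mapping.lookup (free_scale c p) k = c * Poly_Mapping.lookup p k"
  by (simp add: free_scale_def Poly_Mapping.map.rep_eq when_def)

interpretation free: vector_space free_scale
  by unfold_locales (auto intro!: poly_mapping_eqI simp: lookup_add algebra_simps)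

lemma free_scale_single: "free_scale c (Poly_Mapping.single a z) = Poly_Mapping.single a (c * z)"
  by (rule poly_mapping_eqI) (simp add: lookup_single when_def)

lemma free_induct [case_names zero single add]:
  assumes "P 0" "\<And>a z. P (Poly_Mapping.single a z)" "\<And>p q. P p \<Longrightarrow> P q \<Longrightarrow> P (p + q)"
  shows "P (p :: 'a \<Rightarrow>\<^sub>0 complex)"
proof (induction p rule: Poly_Mapping.update_induct)
  case const
  show ?case by (rule assms(1))
next
  case (update f a b)
  have "Poly_Mapping.update a b f = f + Poly_Mapping.single a b"
    using update(1)
    by (intro poly_mapping_eqI) (auto simp: lookup_update lookup_add lookup_single
        when_def Poly_Mapping.in_keys_iff)
  with update show ?case by (simp add: assms)
qed

definition basis_vec :: "'a \<Rightarrow> ('a \<Rightarrow>\<^sub>0 complex)" where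
  "basis_vec a = Poly_Mapping.single a 1"

definition lin_ext :: "('a \<Rightarrow> ('b \<Rightarrow>\<^sub>0 complex)) \<Rightarrow> ('a \<Rightarrow>\<^sub>0 complex) \<Rightarrow> ('b \<Rightarrow>\<^sub>0 complex)" where
  "lin_ext g p = (\<Sum>a\<in>Poly_Mapping.keys p. free_scale (Poly_Mapping.lookup p a) (g a))"

lemma lin_ext_superset:
  assumes "finite A" "Poly_Mapping.keys p \<subseteq> A"
  shows "lin_ext g p = (\<Sum>a\<in>A. free_scale (Poly_Mapping.lookup p a) (g a))"
  unfolding lin_ext_def using assms
  by (intro sum.mono_neutral_left) (auto simp: Poly_Mapping.in_keys_iff)

lemma lin_ext_basis_vec [simp]: "lin_ext g (basis_vec a) = g a"
  by (simp add: lin_ext_def basis_vec_def)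

lemma lin_ext_zero [simp]: "lin_ext g 0 = 0"
  by (simp add: lin_ext_def)

lemma lin_ext_add: "lin_ext g (p + q) = lin_ext g p + lin_ext g q"
proof -
  let ?A = "Poly_Mapping.keys p \<union> Poly_Mapping.keys q"
  have "Poly_Mapping.keys (p + q) \<subseteq> ?A"
    by (rule Poly_Mapping.keys_add)
  then show ?thesis
    by (simp add: lin_ext_superset[of ?A] lookup_add free.scale_left_distrib sum.distrib)
qed

lemma lin_ext_scale: "lin_ext g (free_scale c p) = free_scale c (lin_ext g p)"
proof -
  have "Poly_Mapping.keys (free_scale c p) \<subseteq> Poly_Mapping.keys p"
    by (auto simp: Poly_Mapping.in_keys_iff)
  then show ?thesis
    by (simp add: lin_ext_superset[of "Poly_Mapping.keys p"] free.scale_sum_right)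
qed


section \<open>The toroidal Lie algebra of type \<open>sl\<^sub>2\<close>\<close>

text \<open>\<open>Sl2_H\<close> stands for the coroot \<open>\<alpha>\<^sup>\<or>\<close>.\<close>

datatype sl2_basis = Sl2_E | Sl2_F | Sl2_H

type_synonym sl2 = "sl2_basis \<Rightarrow>\<^sub>0 complex"

fun sl2_bracket :: "sl2_basis \<Rightarrow> sl2_basis \<Rightarrow> sl2" where
  "sl2_bracket Sl2_E Sl2_F = basis_vec Sl2_H"
| "sl2_bracket Sl2_F Sl2_E = - basis_vec Sl2_H"
| "sl2_bracket Sl2_H Sl2_E = free_scale 2 (basis_vec Sl2_E)"
| "sl2_bracket Sl2_E Sl2_H = - free_scale 2 (basis_vec Sl2_E)"
| "sl2_bracket Sl2_H Sl2_F = - free_scale 2 (basis_vec Sl2_F)"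
| "sl2_bracket Sl2_F Sl2_H = free_scale 2 (basis_vec Sl2_F)"
| "sl2_bracket _ _ = 0"

fun sl2_form :: "sl2_basis \<Rightarrow> sl2_basis \<Rightarrow> complex" where
  "sl2_form Sl2_E Sl2_F = 1"
| "sl2_form Sl2_F Sl2_E = 1"
| "sl2_form Sl2_H Sl2_H = 2"
| "sl2_form _ _ = 0"

text \<open>\<open>Loop x m n\<close> is the basis vector \<open>x(m,n) = x \<otimes> t\<^sub>1\<^sup>m t\<^sub>2\<^sup>n\<close>.\<close>

datatype tor_basis = Loop sl2_basis int int | C1 | C2 | D1 | D2

type_synonym toroidal = "tor_basis \<Rightarrow>\<^sub>0 complex"

definition loop :: "sl2 \<Rightarrow> int \<Rightarrow> int \<Rightarrow> toroidal" where
  "loop x m n = lin_ext (\<lambda>a. basis_vec (Loop a m n)) x"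

fun tor_bracket_basis :: "tor_basis \<Rightarrow> tor_basis \<Rightarrow> toroidal" where
  "tor_bracket_basis (Loop a r1 r2) (Loop b s1 s2) =
     loop (sl2_bracket a b) (r1 + s1) (r2 + s2) +
     (if r1 = - s1 \<and> r2 = - s2
      then free_scale (sl2_form a b)
             (free_scale (of_int r1) (basis_vec C1) + free_scale (of_int r2) (basis_vec C2))
      else 0)"
| "tor_bracket_basis D1 (Loop a r1 r2) = free_scale (of_int r1) (basis_vec (Loop a r1 r2))"
| "tor_bracket_basis D2 (Loop a r1 r2) = free_scale (of_int r2) (basis_vec (Loop a r1 r2))"
| "tor_bracket_basis (Loop a r1 r2) D1 = - free_scale (of_int r1) (basis_vec (Loop a r1 r2))"
| "tor_bracket_basis (Loop a r1 r2) D2 = - free_scale (of_int r2) (basis_vec (Loop a r1 r2))"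
| "tor_bracket_basis _ _ = 0"

definition tor_bracket :: "toroidal \<Rightarrow> toroidal \<Rightarrow> toroidal" where
  "tor_bracket x y = lin_ext (\<lambda>a. lin_ext (\<lambda>b. tor_bracket_basis a b) y) x"

definition tor_e :: "int \<Rightarrow> int \<Rightarrow> toroidal" where
  "tor_e m n = basis_vec (Loop Sl2_E m n)"

definition tor_f :: "int \<Rightarrow> int \<Rightarrow> toroidal" where
  "tor_f m n = basis_vec (Loop Sl2_F m n)"

definition tor_h :: "int \<Rightarrow> int \<Rightarrow> toroidal" where
  "tor_h m n = basis_vec (Loop Sl2_H m n)"

definition cartan :: "toroidal set" where
  "cartan = free.span {tor_h 0 0, basis_vec C1, basis_vec C2, basis_vec D1, basis_vec D2}"

definition tor_plus :: "toroidal set" where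
  "tor_plus = free.span
     ({tor_e m 0 | m. m \<ge> 0} \<union> {tor_f m 0 | m. m \<ge> 1} \<union> {tor_h m 0 | m. m \<ge> 1}
      \<union> {loop x m n | x m n. n \<ge> 1})"

definition tor_minus :: "toroidal set" where
  "tor_minus = free.span
     ({tor_f (- m) 0 | m. m \<ge> 0} \<union> {tor_e (- m) 0 | m. m \<ge> 1} \<union> {tor_h (- m) 0 | m. m \<ge> 1}
      \<union> {loop x m (- n) | x m n. n \<ge> 1})"

definition coroot1 :: toroidal where
  "coroot1 = tor_h 0 0"

definition coroot0 :: toroidal where
  "coroot0 = basis_vec C1 - tor_h 0 0"

text \<open>The dual space \<open>\<hh>\<^sup>*\<close>; extensionality gives each functional on \<^const>\<open>cartan\<close>
  exactly one representative.\<close>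

definition cartan_dual :: "(toroidal \<Rightarrow> complex) set" where
  "cartan_dual = {\<mu> \<in> extensional cartan.
     (\<forall>x\<in>cartan. \<forall>y\<in>cartan. \<mu> (x + y) = \<mu> x + \<mu> y) \<and>
     (\<forall>c. \<forall>x\<in>cartan. \<mu> (free_scale c x) = c * \<mu> x)}"


section \<open>The universal enveloping algebra\<close>

text \<open>The tensor algebra of \<^typ>\<open>toroidal\<close> is the free associative algebra on
  \<^typ>\<open>tor_basis\<close>, that is, the monoid algebra of the words in \<^typ>\<open>tor_basis\<close>.
  The monoid is written additively because the convolution product of
  \<^theory>\<open>HOL-Library.Poly_Mapping\<close> expects that.\<close>

datatype 'a free_word = Word (letters: "'a list")

instantiation free_word :: (type) monoid_add
begin

definition zero_free_word :: "'a free_word" where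
  "zero_free_word = Word []"

definition plus_free_word :: "'a free_word \<Rightarrow> 'a free_word \<Rightarrow> 'a free_word" where
  "plus_free_word v w = Word (letters v @ letters w)"

instance
  by standard (simp_all add: zero_free_word_def plus_free_word_def)

end

type_synonym tor_tensor = "tor_basis free_word \<Rightarrow>\<^sub>0 complex"

definition tensor_incl :: "toroidal \<Rightarrow> tor_tensor" where
  "tensor_incl = lin_ext (\<lambda>a. basis_vec (Word [a]))"

lemma free_scale_mult_left: "free_scale c (p * q) = free_scale c p * (q :: tor_tensor)"
  and free_scale_mult_right: "free_scale c (p * q) = p * free_scale c (q :: tor_tensor)"
proof -
  have L: "free_scale c r = Poly_Mapping.single 0 c * r" for r :: tor_tensor
    by (induction r rule: free_induct)
      (simp_all add: free_scale_single mult_single free.scale_right_distrib distrib_left)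
  have R: "free_scale c r = r * Poly_Mapping.single 0 c" for r :: tor_tensor
    by (induction r rule: free_induct)
      (simp_all add: free_scale_single mult_single free.scale_right_distrib distrib_right mult.commute)
  show "free_scale c (p * q) = free_scale c p * q"
    by (simp add: L mult.assoc)
  show "free_scale c (p * q) = p * free_scale c q"
    by (simp add: R mult.assoc)
qed

definition env_ideal :: "tor_tensor set" where
  "env_ideal = free.span
     {a * (tensor_incl x * tensor_incl y - tensor_incl y * tensor_incl x
           - tensor_incl (tor_bracket x y)) * b | a x y b. True}"

lemma env_ideal_zero: "0 \<in> env_ideal"
  and env_ideal_add: "p \<in> env_ideal \<Longrightarrow> q \<in> env_ideal \<Longrightarrow> p + q \<in> env_ideal"
  and env_ideal_diff: "p \<in> env_ideal \<Longrightarrow> q \<in> env_ideal \<Longrightarrow> p - q \<in> env_ideal"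
  and env_ideal_scale: "p \<in> env_ideal \<Longrightarrow> free_scale c p \<in> env_ideal"
  by (simp_all add: env_ideal_def free.span_zero free.span_add free.span_diff free.span_scale)

lemma env_ideal_mult:
  assumes "p \<in> env_ideal"
  shows "u * p * w \<in> env_ideal"
  using assms unfolding env_ideal_def
proof (induction rule: free.span_induct_alt)
  case base
  show ?case by (simp add: free.span_zero)
next
  case (step c g q)
  then obtain a x y b where g: "g = a * (tensor_incl x * tensor_incl y
      - tensor_incl y * tensor_incl x - tensor_incl (tor_bracket x y)) * b"
    by blast
  have "u * g * w = (u * a) * (tensor_incl x * tensor_incl y
      - tensor_incl y * tensor_incl x - tensor_incl (tor_bracket x y)) * (b * w)"
    unfolding g by (simp only: mult.assoc)
  then have "u * g * w \<in> env_ideal"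
    unfolding env_ideal_def by (intro free.span_base) blast
  moreover have "u * (free_scale c g + q) * w = free_scale c (u * g * w) + u * q * w"
    by (simp add: distrib_left distrib_right free_scale_mult_left[symmetric]
        free_scale_mult_right[symmetric])
  ultimately show ?case
    using step.IH by (simp add: env_ideal_def free.span_add free.span_scale)
qed

lemma env_ideal_mult_left: "p \<in> env_ideal \<Longrightarrow> u * p \<in> env_ideal"
  and env_ideal_mult_right: "p \<in> env_ideal \<Longrightarrow> p * w \<in> env_ideal"
  using env_ideal_mult[of p u 1] env_ideal_mult[of p 1 w] by simp_all

text \<open>The augmentation (constant term) shows that the ideal is proper.\<close>

lemma free_word_add_eq_zero_iff: "v + w = (0 :: 'a free_word) \<longleftrightarrow> v = 0 \<and> w = 0"
  by (cases v; cases w) (simp add: plus_free_word_def zero_free_word_def)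

lemma lookup_mult_zero:
  "Poly_Mapping.lookup (p * q) 0 = Poly_Mapping.lookup p 0 * Poly_Mapping.lookup (q :: tor_tensor) 0"
proof (induction p rule: free_induct)
  case (single v z)
  show ?case
    by (induction q rule: free_induct)
      (auto simp: mult_single lookup_single when_def free_word_add_eq_zero_iff distrib_left lookup_add)
qed (simp_all add: distrib_right lookup_add)

lemma lookup_tensor_incl_zero: "Poly_Mapping.lookup (tensor_incl x) 0 = 0"
  by (simp add: tensor_incl_def lin_ext_def lookup_sum basis_vec_def lookup_single
      zero_free_word_def when_def)

lemma lookup_env_ideal_zero: "p \<in> env_ideal \<Longrightarrow> Poly_Mapping.lookup p 0 = 0"
  unfolding env_ideal_def
  by (induction rule: free.span_induct_alt)
    (auto simp: lookup_add lookup_minus lookup_mult_zero lookup_tensor_incl_zero)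

definition env_cong :: "tor_tensor \<Rightarrow> tor_tensor \<Rightarrow> bool" where
  "env_cong p q \<longleftrightarrow> p - q \<in> env_ideal"

quotient_type tor_env = tor_tensor / env_cong
proof (rule equivpI)
  show "reflp env_cong"
    by (simp add: reflp_def env_cong_def env_ideal_zero)
  show "symp env_cong"
    using env_ideal_diff[OF env_ideal_zero] by (force simp: symp_def env_cong_def)
  show "transp env_cong"
    using env_ideal_add by (force simp: transp_def env_cong_def)
qed

instantiation tor_env :: ring_1
begin

lift_definition zero_tor_env :: tor_env is 0 .

lift_definition one_tor_env :: tor_env is 1 .

lift_definition plus_tor_env :: "tor_env \<Rightarrow> tor_env \<Rightarrow> tor_env" is "(+)"
  unfolding env_cong_def using env_ideal_add by (force simp: algebra_simps)

lift_definition minus_tor_env :: "tor_env \<Rightarrow> tor_env \<Rightarrow> tor_env" is "(-)"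
  unfolding env_cong_def using env_ideal_diff by (force simp: algebra_simps)

lift_definition uminus_tor_env :: "tor_env \<Rightarrow> tor_env" is uminus
  unfolding env_cong_def using env_ideal_diff[OF env_ideal_zero] by force

lift_definition times_tor_env :: "tor_env \<Rightarrow> tor_env \<Rightarrow> tor_env" is "(*)"
proof -
  fix p p' q q' :: tor_tensor
  assume "env_cong p p'" "env_cong q q'"
  then have "(p - p') * q + p' * (q - q') \<in> env_ideal"
    unfolding env_cong_def
    by (intro env_ideal_add env_ideal_mult_left env_ideal_mult_right)
  then show "env_cong (p * q) (p' * q')"
    unfolding env_cong_def by (simp add: algebra_simps)
qed

instance
proof
  show "0 \<noteq> (1 :: tor_env)"
    by transfer (auto simp: env_cong_def dest: lookup_env_ideal_zero)
qed (transfer; simp add: env_cong_def env_ideal_zero algebra_simps)+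

end

lift_definition env_scale :: "complex \<Rightarrow> tor_env \<Rightarrow> tor_env" is free_scale
  unfolding env_cong_def by (metis env_ideal_scale free.scale_right_diff_distrib)

interpretation env: vector_space env_scale
  by unfold_locales
    (transfer; simp add: env_cong_def env_ideal_zero free.scale_left_distrib free.scale_right_distrib)+

lift_definition env_incl :: "toroidal \<Rightarrow> tor_env" is tensor_incl .

lemma env_incl_bracket:
  "env_incl (tor_bracket x y) = env_incl x * env_incl y - env_incl y * env_incl x"
proof transfer
  fix x y
  have "1 * (tensor_incl x * tensor_incl y - tensor_incl y * tensor_incl x
      - tensor_incl (tor_bracket x y)) * 1 \<in> env_ideal"
    unfolding env_ideal_def by (rule free.span_base) blast
  then show "env_cong (tensor_incl (tor_bracket x y))
      (tensor_incl x * tensor_incl y - tensor_incl y * tensor_incl x)"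
    using env_ideal_diff[OF env_ideal_zero] by (force simp: env_cong_def)
qed

text \<open>By the Poincare-Birkhoff-Witt theorem, the enveloping algebra of a subalgebra is the
  associative subalgebra of \<^typ>\<open>tor_env\<close> that it generates.\<close>

definition env_minus :: "tor_env set" where
  "env_minus = env.span {prod_list (map env_incl xs) | xs. set xs \<subseteq> tor_minus}"


section \<open>Modules\<close>

text \<open>A module over the toroidal Lie algebra is treated as a left module over its enveloping
  algebra: \<open>x\<close> acts as \<^term>\<open>env_incl x\<close>. The fields \<open>mult\<close> and \<open>one\<close>, inherited from the
  ring record, carry no meaning.\<close>

record 'v env_module = "(complex, 'v) module" +
  act :: "tor_env \<Rightarrow> 'v \<Rightarrow> 'v"

definition quot_module :: "'v env_module \<Rightarrow> 'v set \<Rightarrow> 'v set env_module" where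
  "quot_module M S =
     \<lparr>carrier = a_rcosets\<^bsub>M\<^esub> S, mult = undefined, one = undefined,
      zero = S, add = (\<lambda>A B. A <+>\<^bsub>M\<^esub> B),
      smult = (\<lambda>c A. \<Union>v\<in>A. S +>\<^bsub>M\<^esub> (c \<odot>\<^bsub>M\<^esub> v)),
      act = (\<lambda>u A. \<Union>v\<in>A. S +>\<^bsub>M\<^esub> act M u v)\<rparr>"

definition weight_space :: "'v env_module \<Rightarrow> (toroidal \<Rightarrow> complex) \<Rightarrow> 'v set" where
  "weight_space M \<mu> =
     {v \<in> carrier M. \<forall>h\<in>cartan. act M (env_incl h) v = \<mu> h \<odot>\<^bsub>M\<^esub> v}"

text \<open>The direct sum decomposition: every vector is in a unique way a finite sum of
  components in the weight spaces.\<close>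

definition weight_module :: "'v env_module \<Rightarrow> bool" where
  "weight_module M \<longleftrightarrow>
     (\<forall>v\<in>carrier M. \<exists>!g. g \<in> (\<Pi>\<^sub>E \<mu>\<in>cartan_dual. weight_space M \<mu>) \<and>
        finite {\<mu> \<in> cartan_dual. g \<mu> \<noteq> \<zero>\<^bsub>M\<^esub>} \<and>
        v = (\<Oplus>\<^bsub>M\<^esub>\<mu>\<in>{\<mu> \<in> cartan_dual. g \<mu> \<noteq> \<zero>\<^bsub>M\<^esub>}. g \<mu>))"

definition locally_nilpotent :: "'v env_module \<Rightarrow> toroidal \<Rightarrow> bool" where
  "locally_nilpotent M z \<longleftrightarrow>
     (\<forall>v\<in>carrier M. \<exists>N::nat. (act M (env_incl z) ^^ N) v = \<zero>\<^bsub>M\<^esub>)"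

definition integrable_module :: "'v env_module \<Rightarrow> bool" where
  "integrable_module M \<longleftrightarrow> weight_module M \<and>
     (\<forall>m n. locally_nilpotent M (tor_e m n) \<and> locally_nilpotent M (tor_f m n))"


section \<open>Verma modules and the modules \<open>W(\<lambda>)\<close>\<close>

text \<open>The tensor product of the enveloping algebra with the line \<open>\<complex> 1\<^sub>\<lambda>\<close>, over the enveloping
  algebra of \<open>\<TT>\<^sub>+ \<oplus> \<hh>\<close>, is the free vector space on the pairs \<open>(u, z)\<close>, read as
  \<open>u \<otimes> z 1\<^sub>\<lambda>\<close>, modulo \<open>verma_rel\<close>. It suffices to impose the balancing relations for elements
  of \<open>\<TT>\<^sub>+\<close> and of \<open>\<hh>\<close>, since these generate the enveloping algebra of \<open>\<TT>\<^sub>+ \<oplus> \<hh>\<close>.\<close>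

type_synonym pre_verma = "tor_env \<times> complex \<Rightarrow>\<^sub>0 complex"

definition verma_rel :: "(toroidal \<Rightarrow> complex) \<Rightarrow> pre_verma set" where
  "verma_rel lam = free.span
     ({basis_vec (u + u', z) - basis_vec (u, z) - basis_vec (u', z) | u u' z. True}
      \<union> {basis_vec (u, z + z') - basis_vec (u, z) - basis_vec (u, z') | u z z'. True}
      \<union> {basis_vec (env_scale c u, z) - free_scale c (basis_vec (u, z)) | c u z. True}
      \<union> {basis_vec (u, c * z) - free_scale c (basis_vec (u, z)) | c u z. True}
      \<union> {basis_vec (u * env_incl x, z) - basis_vec (u, 0) | u x z. x \<in> tor_plus}
      \<union> {basis_vec (u * env_incl h, z) - basis_vec (u, lam h * z) | u h z. h \<in> cartan})"

definition pre_verma :: "pre_verma env_module" where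
  "pre_verma =
     \<lparr>carrier = UNIV, mult = undefined, one = undefined, zero = 0, add = (+),
      smult = free_scale, act = (\<lambda>w. lin_ext (\<lambda>(u, z). basis_vec (w * u, z)))\<rparr>"

definition verma :: "(toroidal \<Rightarrow> complex) \<Rightarrow> pre_verma set env_module" where
  "verma lam = quot_module pre_verma (verma_rel lam)"

definition verma_vec :: "(toroidal \<Rightarrow> complex) \<Rightarrow> pre_verma set" where
  "verma_vec lam = verma_rel lam +>\<^bsub>pre_verma\<^esub> basis_vec (1, 1)"

text \<open>\<open>U(\<TT>\<^sub>-) y\<^sup>k v\<^sub>\<lambda>\<close>\<close>

definition verma_sub :: "(toroidal \<Rightarrow> complex) \<Rightarrow> toroidal \<Rightarrow> nat \<Rightarrow> pre_verma set set" where
  "verma_sub lam y k =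
     {act (verma lam) u ((act (verma lam) (env_incl y) ^^ k) (verma_vec lam)) | u. u \<in> env_minus}"

definition weyl_module ::
    "(toroidal \<Rightarrow> complex) \<Rightarrow> nat \<Rightarrow> nat \<Rightarrow> pre_verma set set env_module" where
  "weyl_module lam n0 n1 = quot_module (verma lam)
     (verma_sub lam (tor_e (- 1) 0) (n0 + 1) <+>\<^bsub>verma lam\<^esub> verma_sub lam (tor_f 0 0) (n1 + 1))"

end

theory Submission
  imports Defs
begin

text \<open>
  Why \<open>W(\<lambda>)\<close> is not integrable: let \<open>v\<close> be the image of \<open>v\<^sub>\<lambda>\<close>. For every integer \<open>m\<close>, the real
  root vectors \<open>e(m,1)\<close> and \<open>f(-m,-1)\<close> span, together with \<open>h = \<alpha>\<^sup>\<or> + m c\<^sub>1 + c\<^sub>2\<close>, a copy of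
  \<open>sl\<^sub>2\<close>. Since \<open>e(m,1)\<close> lies in \<open>\<TT>\<^sub>+\<close> whatever the sign of \<open>m\<close>, the vector \<open>v\<close> is a highest
  weight vector for this \<open>sl\<^sub>2\<close>, of weight \<open>\<lambda>(h) = n\<^sub>1 + m k\<^sub>1\<close>. For \<open>m\<close> very negative this
  weight is negative, so \<open>e(m,1)\<^sup>N f(-m,-1)\<^sup>N v\<close> is a nonzero multiple of \<open>v\<close> for all \<open>N\<close>, and
  \<open>f(-m,-1)\<close> cannot be locally nilpotent, provided that \<open>v \<noteq> 0\<close>.

  The substance of the proof is therefore that \<open>v \<noteq> 0\<close>. Instead of deducing this from a
  Poincare-Birkhoff-Witt basis, the proof constructs a functional that detects it: the
  Harish-Chandra functional \<open>\<Phi>\<close> on the enveloping algebra \<open>U\<close>, which satisfies \<open>\<Phi>(1) = 1\<close>,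
  \<open>\<Phi>(u x) = 0\<close> for \<open>x \<in> \<TT>\<^sub>+\<close>, \<open>\<Phi>(u h) = \<lambda>(h) \<Phi>(u)\<close> for \<open>h \<in> \<hh>\<close>, and \<open>\<Phi>(y u) = 0\<close> for
  \<open>y \<in> \<TT>\<^sub>-\<close>. These rules suggest a recursion on the length of a word: a last letter \<open>y \<in> \<TT>\<^sub>-\<close>
  can be commuted to the front, where the word vanishes, so that \<open>\<Phi>(w y)\<close> is the sum of the values
  of \<open>\<Phi>\<close> on the words obtained from \<open>w\<close> by replacing one letter \<open>a\<close> by \<open>[a, y]\<close>. Taken as a
  definition on words, this recursion respects the relations \<open>a b - b a = [a, b]\<close>; the proof
  (\<open>hc_at_swap\<close>) rests on the Jacobi identity and on the fact that \<open>\<TT>\<^sub>-\<close> and \<open>\<TT>\<^sub>+ \<oplus> \<hh>\<close> are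
  subalgebras, the second with a character that extends \<open>\<lambda>\<close>.

  A functional with the last three properties is determined by its value at \<open>1\<close> (\<open>eq_zero\<close>).
  If \<open>s = y\<^sub>i\<^bsup>n\<^sub>i+1\<^esup>\<close>, the vector \<open>s v\<^sub>\<lambda>\<close> is singular of some weight, so \<open>u \<mapsto> \<Phi>(u s)\<close> is such a
  functional, for another weight; it vanishes at \<open>1\<close>, hence everywhere (\<open>hc_env_singular\<close>). Thus all
  the functionals \<open>u \<mapsto> \<Phi>(b u)\<close>, with \<open>b \<in> U\<close>, descend to \<open>W(\<lambda>)\<close>. If \<open>f(-m,-1)\<^sup>N\<close> killed \<open>v\<close>,
  the one with \<open>b = e(m,1)\<^sup>N\<close> would give \<open>\<Phi>(e(m,1)\<^sup>N f(-m,-1)\<^sup>N) = 0\<close>, contrary to the \<open>sl\<^sub>2\<close>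
  computation (\<open>hc_env_string_nonzero\<close>).
\<close>

section \<open>Functionals on words\<close>

text \<open>If \<open>G\<close> is multilinear, this is \<open>G\<close> applied to the image of the word under the derivation of the
  tensor algebra that extends \<open>d\<close>. Working with \<open>G\<close> on lists avoids the tensor algebra itself.\<close>

fun leibniz :: "('a \<Rightarrow> 'a) \<Rightarrow> ('a list \<Rightarrow> 'b::ab_group_add) \<Rightarrow> 'a list \<Rightarrow> 'b" where
  "leibniz d G [] = 0"
| "leibniz d G (a # as) = G (d a # as) + leibniz d (\<lambda>w. G (a # w)) as"

lemma leibniz_append:
  "leibniz d G (us @ vs) = leibniz d (\<lambda>u. G (u @ vs)) us + leibniz d (\<lambda>v. G (us @ v)) vs"
  by (induction us arbitrary: G) (simp_all add: add.assoc)

lemma leibniz_add: "leibniz d (\<lambda>w. G w + H w) ws = leibniz d G ws + leibniz d H ws"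
  by (induction ws arbitrary: G H) (simp_all add: algebra_simps)

lemma leibniz_additive:
  assumes "\<And>x y. f (x + y) = f x + f y" "f 0 = 0"
  shows "leibniz d (\<lambda>w. f (G w)) ws = f (leibniz d G ws)"
  using assms by (induction ws arbitrary: G) simp_all

lemma leibniz_mult_left: "leibniz d (\<lambda>w. c * G w) ws = (c :: 'b::ring) * leibniz d G ws"
  by (rule leibniz_additive) (simp_all add: distrib_left)

lemma leibniz_same_length_eq_zero:
  "(\<And>w. length w = length ws \<Longrightarrow> G w = 0) \<Longrightarrow> leibniz d G ws = 0"
  by (induction ws arbitrary: G) simp_all

locale multilinear =
  fixes scale :: "complex \<Rightarrow> 'a::ab_group_add \<Rightarrow> 'a" and G :: "'a list \<Rightarrow> complex"
  assumes add: "G (us @ (x + y) # vs) = G (us @ x # vs) + G (us @ y # vs)"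
    and scale: "G (us @ scale c x # vs) = c * G (us @ x # vs)"
begin

lemma add_Cons: "G ((x + y) # vs) = G (x # vs) + G (y # vs)"
  using add[of "[]"] by simp

lemma scale_Cons: "G (scale c x # vs) = c * G (x # vs)"
  using scale[of "[]"] by simp

lemma multilinear_Cons: "multilinear scale (\<lambda>w. G (a # w))"
  using add[of "a # us" for us] scale[of "a # us" for us] by unfold_locales simp_all

lemma zero: "G (us @ 0 # vs) = 0"
  using add[of us 0 0 vs] by simp

end

lemma leibniz_add_derivation:
  assumes "multilinear scale G"
  shows "leibniz (\<lambda>a. d1 a + d2 a) G ws = leibniz d1 G ws + leibniz d2 G ws"
  using assms
proof (induction ws arbitrary: G)
  case (Cons a ws)
  then show ?case
    using multilinear.add_Cons[OF Cons.prems] Cons.IH[OF multilinear.multilinear_Cons[OF Cons.prems]]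
    by (simp add: algebra_simps)
qed simp

lemma leibniz_scale_derivation:
  assumes "multilinear scale G"
  shows "leibniz (\<lambda>a. scale c (d a)) G ws = c * leibniz d G ws"
  using assms
proof (induction ws arbitrary: G)
  case (Cons a ws)
  then show ?case
    using multilinear.scale_Cons[OF Cons.prems] Cons.IH[OF multilinear.multilinear_Cons[OF Cons.prems]]
    by (simp add: algebra_simps)
qed simp

text \<open>Extending a linear map to a derivation of the tensor algebra commutes with commutators.\<close>

lemma leibniz_commutator:
  assumes "multilinear scale G" "\<And>a. d2 (d1 a) = d1 (d2 a) + d3 a"
  shows "leibniz d1 (leibniz d2 G) ws = leibniz d2 (leibniz d1 G) ws + leibniz d3 G ws"
  using assms(1)
proof (induction ws arbitrary: G)
  case (Cons a ws)
  then show ?case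
    using multilinear.add_Cons[OF Cons.prems] Cons.IH[OF multilinear.multilinear_Cons[OF Cons.prems]]
    by (simp add: algebra_simps leibniz_add assms(2))
qed simp

lemma multilinear_leibniz:
  assumes G: "multilinear scale G"
    and d: "\<And>x y. d (x + y) = d x + d y" "\<And>c x. d (scale c x) = scale c (d x)"
  shows "multilinear scale (leibniz d G)"
proof
  fix us vs x y c
  interpret multilinear scale G by fact
  show "leibniz d G (us @ (x + y) # vs) = leibniz d G (us @ x # vs) + leibniz d G (us @ y # vs)"
    by (simp add: leibniz_append add d leibniz_add algebra_simps)
  show "leibniz d G (us @ scale c x # vs) = c * leibniz d G (us @ x # vs)"
    by (simp add: leibniz_append scale d leibniz_mult_left algebra_simps)
qed


text \<open>The example to keep in mind: a Lie algebra \<open>L = N \<oplus> B\<close>, a direct sum of two subalgebras, with the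
  projection \<open>neg\<close> onto \<open>N\<close> along \<open>B\<close> and with \<open>chi\<close> vanishing on \<open>N\<close> and restricting to a
  one-dimensional representation of \<open>B\<close>. The identities \<open>neg_bracket\<close> and \<open>chi_bracket\<close> are
  bilinear, and running through the four cases where \<open>x\<close> and \<open>y\<close> lie in \<open>N\<close> or \<open>B\<close> shows that, for an
  antisymmetric bracket, they say exactly that \<open>N\<close> and \<open>B\<close> are closed under the bracket and that \<open>chi\<close> kills the brackets of
  \<open>N\<close> and those of \<open>B\<close>. The Jacobi identity is stated as the derivation property of right
  bracketing, because letters are commuted to the left past the others.\<close>

locale triangular_character =
  fixes scale :: "complex \<Rightarrow> 'a::ab_group_add \<Rightarrow> 'a"
    and bracket :: "'a \<Rightarrow> 'a \<Rightarrow> 'a" and neg :: "'a \<Rightarrow> 'a" and chi :: "'a \<Rightarrow> complex"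
  assumes bracket_add_left: "bracket (x + y) z = bracket x z + bracket y z"
    and bracket_add_right: "bracket x (y + z) = bracket x y + bracket x z"
    and bracket_scale_left: "bracket (scale c x) y = scale c (bracket x y)"
    and bracket_scale_right: "bracket x (scale c y) = scale c (bracket x y)"
    and jacobi: "bracket (bracket x y) z = bracket (bracket x z) y + bracket x (bracket y z)"
    and neg_add: "neg (x + y) = neg x + neg y"
    and neg_scale: "neg (scale c x) = scale c (neg x)"
    and chi_add: "chi (x + y) = chi x + chi y"
    and chi_scale: "chi (scale c x) = c * chi x"
    and neg_bracket: "neg (bracket x y) = neg (bracket x (neg y)) - neg (bracket y (neg x))
      + bracket (neg y) (neg x)"
    and chi_bracket: "chi (bracket x y) = chi (bracket x (neg y)) - chi (bracket y (neg x))"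
begin

text \<open>The value of the Harish-Chandra functional on a word of length \<open>n\<close>. Words are read backwards, so
  that the head of the list is the last letter of the word, on which the recursion operates. Making
  the length a parameter, with value \<open>0\<close> on all lists of another length, turns the recursion into a
  primitive one and makes every \<open>hc_at n\<close> multilinear on all lists.\<close>

primrec hc_at :: "nat \<Rightarrow> 'a list \<Rightarrow> complex" where
  "hc_at 0 ws = (if ws = [] then 1 else 0)"
| "hc_at (Suc n) ws = (case ws of [] \<Rightarrow> 0
     | x # xs \<Rightarrow> chi x * hc_at n xs + leibniz (\<lambda>a. bracket a (neg x)) (hc_at n) xs)"

declare hc_at.simps(2) [simp del]

lemma hc_at_Suc_Nil [simp]: "hc_at (Suc n) [] = 0"
  and hc_at_Suc_Cons: "hc_at (Suc n) (x # xs) =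
    chi x * hc_at n xs + leibniz (\<lambda>a. bracket a (neg x)) (hc_at n) xs"
  by (simp_all add: hc_at.simps(2))

lemma multilinear_hc_at: "multilinear scale (hc_at n)"
proof (induction n)
  case 0
  show ?case by unfold_locales simp_all
next
  case (Suc n)
  interpret multilinear scale "hc_at n" by fact
  have D: "multilinear scale (leibniz (\<lambda>a. bracket a y) (hc_at n))" for y
    by (rule multilinear_leibniz[OF Suc]) (simp_all add: bracket_add_left bracket_scale_left)
  show ?case
  proof
    fix us vs x y c
    show "hc_at (Suc n) (us @ (x + y) # vs) = hc_at (Suc n) (us @ x # vs) + hc_at (Suc n) (us @ y # vs)"
      by (cases us) (simp_all add: hc_at_Suc_Cons chi_add neg_add bracket_add_right
          leibniz_add_derivation[OF Suc] add multilinear.add[OF D] algebra_simps)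
    show "hc_at (Suc n) (us @ scale c x # vs) = c * hc_at (Suc n) (us @ x # vs)"
      by (cases us) (simp_all add: hc_at_Suc_Cons chi_scale neg_scale bracket_scale_right
          leibniz_scale_derivation[OF Suc] scale multilinear.scale[OF D] algebra_simps)
  qed
qed

lemma hc_at_other_length: "length ws \<noteq> n \<Longrightarrow> hc_at n ws = 0"
proof (induction n arbitrary: ws)
  case (Suc n)
  then show ?case
    by (cases ws) (simp_all add: hc_at_Suc_Cons leibniz_same_length_eq_zero)
qed simp

text \<open>The functional respects the defining relations of the enveloping algebra. If some letter \<open>z\<close> stands
  after the two letters in question (before them in the list), the recursion strips it off, and the
  Jacobi identity shows that bracketing with \<open>neg z\<close> maps a relation to a sum of relations. These
  stand in words without \<open>z\<close>, where the induction hypothesis applies. Otherwise both letters are stripped off; what remains is a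
  comparison of the derivations given by \<open>neg a\<close> and \<open>neg b\<close>, whose commutator is the derivation given
  by \<open>bracket (neg b) (neg a)\<close>.\<close>

lemma hc_at_swap:
  "hc_at (Suc n) (us @ b # a # vs) = hc_at (Suc n) (us @ a # b # vs) + hc_at n (us @ bracket a b # vs)"
proof (induction n arbitrary: us a b vs)
  case 0
  show ?case
    by (simp add: hc_at_other_length del: hc_at.simps)
next
  case (Suc n)
  let ?D = "\<lambda>x. leibniz (\<lambda>a. bracket a x)"
  show ?case
  proof (cases us)
    case Nil
    have comm: "?D (neg b) (?D (neg a) (hc_at n)) vs =
      ?D (neg a) (?D (neg b) (hc_at n)) vs + ?D (bracket (neg b) (neg a)) (hc_at n) vs"
      by (rule leibniz_commutator[where scale = scale and ?d1.0 = "\<lambda>x. bracket x (neg b)"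
            and ?d2.0 = "\<lambda>x. bracket x (neg a)", OF multilinear_hc_at jacobi])
    have neg: "?D (neg (bracket a b)) (hc_at n) vs + ?D (neg (bracket b (neg a))) (hc_at n) vs =
      ?D (neg (bracket a (neg b))) (hc_at n) vs + ?D (bracket (neg b) (neg a)) (hc_at n) vs"
      unfolding leibniz_add_derivation[OF multilinear_hc_at, symmetric]
        bracket_add_right[symmetric] neg_bracket[of a b] by (simp add: algebra_simps)
    show ?thesis
      using comm neg
      by (simp add: Nil hc_at_Suc_Cons leibniz_add leibniz_mult_left chi_bracket[of a b] algebra_simps)
  next
    case (Cons z us')
    interpret multilinear scale "hc_at n" by (rule multilinear_hc_at)
    note IH = Suc.IH[where a = a and b = b] Suc.IH[where a = "bracket a (neg z)" and b = b]
      Suc.IH[where a = a and b = "bracket b (neg z)"]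
    show ?thesis
      by (simp add: Cons hc_at_Suc_Cons leibniz_append IH leibniz_add jacobi[of a b "neg z"] add
          algebra_simps)
  qed
qed

lemma hc_at_Cons_nonnegative:
  assumes "neg x = 0"
  shows "hc_at (Suc n) (x # xs) = chi x * hc_at n xs"
proof -
  have "bracket a 0 = 0" for a
    using bracket_add_right[of a 0 0] by simp
  then show ?thesis
    using leibniz_add_derivation[OF multilinear_hc_at, of "\<lambda>_. 0" "\<lambda>_. 0" n xs]
    by (simp add: hc_at_Suc_Cons assms)
qed

text \<open>The definition treats the last letter of a word specially; this is the mirror statement for the
  first letter. It follows by the same recursion, since bracketing the first letter with an element
  of \<open>N\<close> keeps it in \<open>N\<close>.\<close>

lemma hc_at_first_negative:
  assumes neg: "\<And>x y. neg (bracket (neg x) (neg y)) = bracket (neg x) (neg y)"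
    and chi: "\<And>x. chi (neg x) = 0"
  shows "neg y = y \<Longrightarrow> hc_at n (ws @ [y]) = 0"
proof (induction n arbitrary: ws y)
  case (Suc n)
  show ?case
  proof (cases ws)
    case Nil
    then show ?thesis using chi[of y] Suc.prems by (simp add: hc_at_Suc_Cons)
  next
    case (Cons z ws')
    have "neg (bracket y (neg z)) = bracket y (neg z)" using neg[of y z] Suc.prems by simp
    then show ?thesis
      using Suc by (simp add: Cons hc_at_Suc_Cons leibniz_append leibniz_same_length_eq_zero)
  qed
qed simp

end


section \<open>The toroidal bracket\<close>

lemma lin_ext_minus: "lin_ext g (- p) = - lin_ext g p"
  using lin_ext_scale[of g "- 1" p] by simp

lemma lin_ext_diff: "lin_ext g (p - q) = lin_ext g p - lin_ext g q"
  using lin_ext_add[of g p "- q"] by (simp add: lin_ext_minus)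

lemmas lin_ext_linear = lin_ext_add lin_ext_scale lin_ext_minus lin_ext_diff

lemma lin_ext_fun_add: "lin_ext (\<lambda>a. g a + h a) p = lin_ext g p + lin_ext h p"
  by (simp add: lin_ext_def free.scale_right_distrib sum.distrib)

lemma lin_ext_fun_scale: "lin_ext (\<lambda>a. free_scale c (g a)) p = free_scale c (lin_ext g p)"
  by (simp add: lin_ext_def free.scale_sum_right mult.commute)

lemma single_eq_scale_basis_vec: "Poly_Mapping.single a z = free_scale z (basis_vec a)"
  by (simp add: basis_vec_def free_scale_single)

lemma basis_induct [case_names zero basis scale add]:
  assumes "P 0" "\<And>a. P (basis_vec a)" "\<And>c p. P p \<Longrightarrow> P (free_scale c p)"
    "\<And>p q. P p \<Longrightarrow> P q \<Longrightarrow> P (p + q)"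
  shows "P (p :: 'a \<Rightarrow>\<^sub>0 complex)"
  by (induction p rule: free_induct) (simp_all add: assms single_eq_scale_basis_vec)

lemma tor_bracket_add_left: "tor_bracket (x + y) z = tor_bracket x z + tor_bracket y z"
  and tor_bracket_add_right: "tor_bracket x (y + z) = tor_bracket x y + tor_bracket x z"
  and tor_bracket_scale_left: "tor_bracket (free_scale c x) z = free_scale c (tor_bracket x z)"
  and tor_bracket_scale_right: "tor_bracket x (free_scale c z) = free_scale c (tor_bracket x z)"
  by (simp_all add: tor_bracket_def lin_ext_linear lin_ext_fun_add lin_ext_fun_scale)

lemma tor_bracket_zero [simp]: "tor_bracket 0 y = 0" "tor_bracket x 0 = 0"
  using tor_bracket_scale_left[of 0 0 y] tor_bracket_scale_right[of x 0 0] by simp_all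

lemma tor_bracket_minus: "tor_bracket (- x) y = - tor_bracket x y"
  "tor_bracket x (- y) = - tor_bracket x y"
  using tor_bracket_scale_left[of "- 1" x y] tor_bracket_scale_right[of x "- 1" y] by simp_all

lemma tor_bracket_basis_vec [simp]: "tor_bracket (basis_vec a) (basis_vec b) = tor_bracket_basis a b"
  by (simp add: tor_bracket_def)

lemma tor_bracket_diff: "tor_bracket (x - y) z = tor_bracket x z - tor_bracket y z"
  "tor_bracket x (y - z) = tor_bracket x y - tor_bracket x z"
  using tor_bracket_add_left[of "x - y" y z] tor_bracket_add_right[of x "y - z" z] by simp_all

lemma loop_linear: "loop (x + y) m n = loop x m n + loop y m n"
  "loop (- x) m n = - loop x m n" "loop (free_scale c x) m n = free_scale c (loop x m n)"
  "loop 0 m n = 0" "loop (basis_vec a) m n = basis_vec (Loop a m n)"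
  by (simp_all add: loop_def lin_ext_linear)

lemmas tor_bracket_linear = tor_bracket_add_left tor_bracket_add_right tor_bracket_scale_left
  tor_bracket_scale_right tor_bracket_minus tor_bracket_diff loop_linear

lemma tor_bracket_antisym: "tor_bracket y x = - tor_bracket x y"
proof (induction x rule: basis_induct)
  case (basis a)
  show ?case
  proof (induction y rule: basis_induct)
    case (basis b)
    have "tor_bracket_basis b a = - tor_bracket_basis a b"
    proof (cases "\<exists>x m n y r s. a = Loop x m n \<and> b = Loop y r s")
      case True
      then obtain x m n y r s where ab: "a = Loop x m n" "b = Loop y r s" by blast
      show ?thesis
      proof (cases "r = - m \<and> s = - n")
        case True
        then have rs: "r = - m" "s = - n" by auto
        show ?thesis unfolding ab rs
          by (cases x; cases y; simp add: loop_linear algebra_simps)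
      next
        case False
        then have nz: "\<not> (r = - m \<and> s = - n)" "\<not> (m = - r \<and> n = - s)" by linarith+
        show ?thesis unfolding ab
          by (cases x; cases y; simp add: nz loop_linear add.commute)
      qed
    next
      case False
      then show ?thesis by (cases a; cases b) auto
    qed
    then show ?case by simp
  qed (simp_all add: tor_bracket_linear)
qed (simp_all add: tor_bracket_linear)

lemma tor_bracket_central: "tor_bracket (basis_vec C1) z = 0" "tor_bracket (basis_vec C2) z = 0"
  "tor_bracket z (basis_vec C1) = 0" "tor_bracket z (basis_vec C2) = 0"
proof -
  have "tor_bracket_basis C1 b = 0 \<and> tor_bracket_basis C2 b = 0" for b
    by (cases b) simp_all
  then show "tor_bracket (basis_vec C1) z = 0" "tor_bracket (basis_vec C2) z = 0"
    by (simp_all add: tor_bracket_def) (simp_all add: lin_ext_def)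
  then show "tor_bracket z (basis_vec C1) = 0" "tor_bracket z (basis_vec C2) = 0"
    by (simp_all add: tor_bracket_antisym[of _ z])
qed

text \<open>Inside a further bracket only the loop part matters, which removes the case distinction on the
  cocycle.\<close>

lemma tor_bracket_mod_central:
  "tor_bracket (tor_bracket_basis (Loop x r1 r2) (Loop y s1 s2)) z =
     tor_bracket (loop (sl2_bracket x y) (r1 + s1) (r2 + s2)) z"
  "tor_bracket z (tor_bracket_basis (Loop x r1 r2) (Loop y s1 s2)) =
     tor_bracket z (loop (sl2_bracket x y) (r1 + s1) (r2 + s2))"
  by (simp_all add: tor_bracket_linear tor_bracket_central)

text \<open>The loop parts satisfy the identity because \<open>sl\<^sub>2\<close> is a Lie algebra. The cocycle contributes only
  when the three degrees add up to zero; in that case, the invariance of the form makes the three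
  central terms proportional to the three degrees, so that they cancel.\<close>

lemma tor_jacobi_loop:
  "tor_bracket (tor_bracket_basis (Loop x r1 r2) (Loop y s1 s2)) (basis_vec (Loop z t1 t2)) =
   tor_bracket (tor_bracket_basis (Loop x r1 r2) (Loop z t1 t2)) (basis_vec (Loop y s1 s2))
     + tor_bracket (basis_vec (Loop x r1 r2)) (tor_bracket_basis (Loop y s1 s2) (Loop z t1 t2))"
  (is ?P)
proof (cases "t1 = - r1 - s1 \<and> t2 = - r2 - s2")
  case True
  then have t: "t1 = - r1 - s1" "t2 = - r2 - s2" by auto
  show ?P unfolding tor_bracket_mod_central t
    by (cases x; cases y; cases z; simp add: tor_bracket_linear algebra_simps;
        rule poly_mapping_eqI; simp add: lookup_add lookup_minus algebra_simps)
next
  case False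
  then have nz: "\<not> (r1 + s1 = - t1 \<and> r2 + s2 = - t2)" "\<not> (r1 + t1 = - s1 \<and> r2 + t2 = - s2)"
    "\<not> (r1 = - s1 - t1 \<and> r2 = - s2 - t2)" by linarith+
  show ?P unfolding tor_bracket_mod_central
    by (cases x; cases y; cases z; simp add: nz tor_bracket_linear add_ac)
qed

lemma tor_derivation_loop:
  assumes "d = D1 \<and> k = r1 \<and> l = s1 \<or> d = D2 \<and> k = r2 \<and> l = s2"
  shows "tor_bracket (basis_vec d) (tor_bracket_basis (Loop x r1 r2) (Loop y s1 s2)) =
    free_scale (of_int (k + l)) (tor_bracket_basis (Loop x r1 r2) (Loop y s1 s2))"
  using assms unfolding tor_bracket_mod_central
  by (cases x; cases y) (auto simp: tor_bracket_linear algebra_simps)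

lemma tor_jacobi_basis:
  "tor_bracket (tor_bracket_basis a b) (basis_vec c) =
   tor_bracket (tor_bracket_basis a c) (basis_vec b) + tor_bracket (basis_vec a) (tor_bracket_basis b c)"
proof (cases "(\<exists>x m n. a = Loop x m n) \<and> (\<exists>x m n. b = Loop x m n) \<and> (\<exists>x m n. c = Loop x m n)")
  case True
  then show ?thesis
    using tor_jacobi_loop by blast
next
  case False
  \<comment> \<open>brings \<open>D1\<close> and \<open>D2\<close> to the left, where they act as derivations\<close>
  have swap: "tor_bracket (tor_bracket_basis (Loop x r1 r2) (Loop y s1 s2)) (basis_vec d) =
    - tor_bracket (basis_vec d) (tor_bracket_basis (Loop x r1 r2) (Loop y s1 s2))" for x r1 r2 y s1 s2 d
    by (rule tor_bracket_antisym)
  show ?thesis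
    using False tor_bracket_antisym[of "basis_vec c" "basis_vec b"]
    by (cases a; cases b; cases c;
        simp add: tor_bracket_linear tor_bracket_central swap
          tor_derivation_loop[of D1, OF disjI1, OF conjI, OF refl conjI, OF refl refl]
          tor_derivation_loop[of D2, OF disjI2, OF conjI, OF refl conjI, OF refl refl]
          algebra_simps del: tor_bracket_basis.simps(1))
qed

lemma tor_jacobi:
  "tor_bracket (tor_bracket x y) z = tor_bracket (tor_bracket x z) y + tor_bracket x (tor_bracket y z)"
proof (induction x rule: basis_induct)
  case (basis a)
  show ?case
  proof (induction y rule: basis_induct)
    case (basis b)
    show ?case
    proof (induction z rule: basis_induct)
      case (basis c)
      show ?case by (simp add: tor_jacobi_basis[of a b c])
    qed (simp_all add: tor_bracket_linear free.scale_right_distrib)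
  qed (simp_all add: tor_bracket_linear free.scale_right_distrib)
qed (simp_all add: tor_bracket_linear free.scale_right_distrib)


section \<open>The triangular decomposition\<close>

text \<open>Every basis vector of \<open>\<TT>\<close> is in \<open>\<TT>\<^sub>-\<close>, in \<open>\<hh>\<close> or in \<open>\<TT>\<^sub>+\<close>; the third class is the complement of
  the first two. In degree \<open>(0,0)\<close> the three vectors \<open>f\<close>, \<open>\<alpha>\<^sup>\<or>\<close>, \<open>e\<close> are distributed over the three
  classes.\<close>

fun is_minus :: "tor_basis \<Rightarrow> bool" where
  "is_minus (Loop x m n) \<longleftrightarrow> n < 0 \<or> n = 0 \<and> (m < 0 \<or> m = 0 \<and> x = Sl2_F)"
| "is_minus _ \<longleftrightarrow> False"

fun is_cartan :: "tor_basis \<Rightarrow> bool" where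
  "is_cartan (Loop x m n) \<longleftrightarrow> n = 0 \<and> m = 0 \<and> x = Sl2_H"
| "is_cartan _ \<longleftrightarrow> True"

definition project :: "(tor_basis \<Rightarrow> bool) \<Rightarrow> toroidal \<Rightarrow> toroidal" where
  "project P = lin_ext (\<lambda>a. if P a then basis_vec a else 0)"

lemma project_linear: "project P 0 = 0" "project P (x + y) = project P x + project P y"
  "project P (- x) = - project P x" "project P (x - y) = project P x - project P y"
  "project P (free_scale c x) = free_scale c (project P x)"
  by (simp_all add: project_def lin_ext_linear)

lemma project_basis_vec [simp]: "project P (basis_vec a) = (if P a then basis_vec a else 0)"
  by (simp add: project_def)

lemma lookup_project: "Poly_Mapping.lookup (project P x) a = (if P a then Poly_Mapping.lookup x a else 0)"
  by (induction x rule: basis_induct)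
    (simp_all add: project_linear lookup_add, simp add: basis_vec_def lookup_single when_def)

lemma minus_not_cartan: "is_minus a \<Longrightarrow> \<not> is_cartan a"
  by (cases a) auto

lemma project_cartan_minus: "project is_cartan (project is_minus x) = 0"
  by (induction x rule: basis_induct) (simp_all add: project_linear minus_not_cartan)

lemma bracket_basis_minus:
  assumes "is_minus a" "is_minus b"
  shows "project is_minus (tor_bracket_basis a b) = tor_bracket_basis a b"
    and "project is_cartan (tor_bracket_basis a b) = 0"
proof -
  have "project is_minus (tor_bracket_basis a b) = tor_bracket_basis a b \<and> project is_cartan (tor_bracket_basis a b) = 0"
    using assms
  proof (cases a; cases b)
    fix x m n y r s assume "a = Loop x m n" "b = Loop y r s"
    then show ?thesis
      using assms by (cases x; cases y) (auto simp: loop_linear project_linear)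
  qed simp_all
  then show "project is_minus (tor_bracket_basis a b) = tor_bracket_basis a b"
    "project is_cartan (tor_bracket_basis a b) = 0" by auto
qed

text \<open>So \<open>\<TT>\<^sub>+ \<oplus> \<hh>\<close> is a subalgebra, and its brackets have no component in \<open>\<hh>\<close>, so every linear
  functional on \<open>\<hh>\<close> extends to a character of it by zero on \<open>\<TT>\<^sub>+\<close>.\<close>

lemma bracket_basis_nonminus:
  assumes "\<not> is_minus a" "\<not> is_minus b"
  shows "project is_minus (tor_bracket_basis a b) = 0"
    and "project is_cartan (tor_bracket_basis a b) = 0"
proof -
  have "project is_minus (tor_bracket_basis a b) = 0 \<and> project is_cartan (tor_bracket_basis a b) = 0"
    using assms
  proof (cases a; cases b)
    fix x m n y r s assume "a = Loop x m n" "b = Loop y r s"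
    then show ?thesis
      using assms by (cases x; cases y) (auto simp: loop_linear project_linear)
  qed (auto simp: project_linear)
  then show "project is_minus (tor_bracket_basis a b) = 0"
    "project is_cartan (tor_bracket_basis a b) = 0" by auto
qed

lemma bracket_project_minus:
  "project is_minus (tor_bracket (project is_minus x) (project is_minus y)) =
    tor_bracket (project is_minus x) (project is_minus y)"
proof (induction x rule: basis_induct)
  case (basis a)
  show ?case
  proof (induction y rule: basis_induct)
    case (basis b)
    show ?case by (simp add: bracket_basis_minus project_linear)
  qed (simp_all add: tor_bracket_linear project_linear)
qed (simp_all add: tor_bracket_linear project_linear)

lemma project_bracket:
  defines "neg \<equiv> project is_minus"
  shows "neg (tor_bracket x y) = neg (tor_bracket x (neg y)) - neg (tor_bracket y (neg x))
      + tor_bracket (neg y) (neg x)"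
    and "project is_cartan (tor_bracket x y) =
      project is_cartan (tor_bracket x (neg y)) - project is_cartan (tor_bracket y (neg x))"
proof -
  have anti: "tor_bracket_basis b a = - tor_bracket_basis a b" for a b
    using tor_bracket_antisym[of "basis_vec b" "basis_vec a"] by simp
  have "neg (tor_bracket x y) = neg (tor_bracket x (neg y)) - neg (tor_bracket y (neg x))
      + tor_bracket (neg y) (neg x) \<and> project is_cartan (tor_bracket x y) =
      project is_cartan (tor_bracket x (neg y)) - project is_cartan (tor_bracket y (neg x))"
  proof (induction x rule: basis_induct)
    case (basis a)
    show ?case
    proof (induction y rule: basis_induct)
      case (basis b)
      show ?case
        by (cases "is_minus a"; cases "is_minus b")
          (simp_all add: neg_def bracket_basis_minus bracket_basis_nonminus project_linear anti[of b a])
    qed (simp_all add: neg_def tor_bracket_linear project_linear free.scale_right_distrib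
        free.scale_right_diff_distrib)
  qed (simp_all add: neg_def tor_bracket_linear project_linear free.scale_right_distrib
        free.scale_right_diff_distrib)
  then show "neg (tor_bracket x y) = neg (tor_bracket x (neg y)) - neg (tor_bracket y (neg x))
      + tor_bracket (neg y) (neg x)"
    "project is_cartan (tor_bracket x y) =
      project is_cartan (tor_bracket x (neg y)) - project is_cartan (tor_bracket y (neg x))" by auto
qed

lemma project_cartan_in_cartan: "project is_cartan x \<in> cartan"
proof (induction x rule: basis_induct)
  case (basis a)
  have "is_cartan a \<Longrightarrow> basis_vec a \<in> cartan"
    unfolding cartan_def by (rule free.span_base, cases a) (auto simp: tor_h_def)
  then show ?case by (simp add: cartan_def free.span_zero)
qed (simp_all add: project_linear cartan_def free.span_zero free.span_add free.span_scale)

lemma project_of_mem_cartan: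
  assumes "h \<in> cartan"
  shows "project is_cartan h = h" and "project is_minus h = 0"
proof -
  have "project is_cartan h = h \<and> project is_minus h = 0"
    using assms unfolding cartan_def
    by (induction rule: free.span_induct_alt) (auto simp: project_linear tor_h_def)
  then show "project is_cartan h = h" "project is_minus h = 0" by auto
qed

lemma project_of_mem_tor_plus:
  assumes "x \<in> tor_plus"
  shows "project is_cartan x = 0" and "project is_minus x = 0"
proof -
  have loop: "project is_cartan (loop z m n) = 0 \<and> project is_minus (loop z m n) = 0" if "n \<ge> 1" for z m n
    using that by (induction z rule: basis_induct) (auto simp: loop_linear project_linear)
  have "project is_cartan x = 0 \<and> project is_minus x = 0"
    using assms unfolding tor_plus_def
    by (induction rule: free.span_induct_alt)
      (auto simp: project_linear tor_h_def tor_e_def tor_f_def loop)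
  then show "project is_cartan x = 0" "project is_minus x = 0" by auto
qed

locale highest_weight =
  fixes lam :: "toroidal \<Rightarrow> complex"
  assumes lam_cartan_dual: "lam \<in> cartan_dual"
begin

lemma lam_add: "x \<in> cartan \<Longrightarrow> y \<in> cartan \<Longrightarrow> lam (x + y) = lam x + lam y"
  and lam_scale: "x \<in> cartan \<Longrightarrow> lam (free_scale c x) = c * lam x"
  using lam_cartan_dual by (auto simp: cartan_dual_def)

lemma lam_zero: "lam 0 = 0"
  using lam_scale[of 0 0] by (simp add: cartan_def free.span_zero)

sublocale triangular_character free_scale tor_bracket "project is_minus" "\<lambda>x. lam (project is_cartan x)"
proof
  fix x y z c
  have diff: "lam (x - y) = lam x - lam y" if "x \<in> cartan" "y \<in> cartan" for x y
    using lam_add[of "x - y" y] that by (simp add: cartan_def free.span_diff)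
  show "lam (project is_cartan (tor_bracket x y)) =
      lam (project is_cartan (tor_bracket x (project is_minus y))) -
      lam (project is_cartan (tor_bracket y (project is_minus x)))"
    unfolding project_bracket(2)[of x y] by (rule diff) (rule project_cartan_in_cartan)+
  show "project is_minus (tor_bracket x y) =
      project is_minus (tor_bracket x (project is_minus y)) -
      project is_minus (tor_bracket y (project is_minus x)) +
      tor_bracket (project is_minus y) (project is_minus x)"
    by (rule project_bracket(1))
  show "tor_bracket (tor_bracket x y) z =
      tor_bracket (tor_bracket x z) y + tor_bracket x (tor_bracket y z)"
    by (rule tor_jacobi)
qed (simp_all add: tor_bracket_linear project_linear lam_add lam_scale project_cartan_in_cartan)

end


section \<open>Functionals on the enveloping algebra\<close>

text \<open>The definition of \<^const>\<open>lin_ext\<close> with values in the scalars; as \<open>\<complex>\<close> is the free vector space on one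
  point, linearity is inherited from there.\<close>

definition extend_linearly :: "('a \<Rightarrow> complex) \<Rightarrow> ('a \<Rightarrow>\<^sub>0 complex) \<Rightarrow> complex" where
  "extend_linearly g p = (\<Sum>a\<in>Poly_Mapping.keys p. Poly_Mapping.lookup p a * g a)"

lemma extend_linearly_eq_lookup:
  "extend_linearly g p = Poly_Mapping.lookup (lin_ext (\<lambda>a. Poly_Mapping.single () (g a)) p) ()"
  by (simp add: extend_linearly_def lin_ext_def lookup_sum)

lemma extend_linearly_add: "extend_linearly g (p + q) = extend_linearly g p + extend_linearly g q"
  and extend_linearly_diff: "extend_linearly g (p - q) = extend_linearly g p - extend_linearly g q"
  and extend_linearly_scale: "extend_linearly g (free_scale c p) = c * extend_linearly g p"
  and extend_linearly_zero [simp]: "extend_linearly g 0 = 0"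
  and extend_linearly_basis_vec [simp]: "extend_linearly g (basis_vec a) = g a"
  by (simp_all add: extend_linearly_eq_lookup lin_ext_linear lookup_add lookup_minus)

lemma tensor_incl_linear: "tensor_incl (x + y) = tensor_incl x + tensor_incl y"
  "tensor_incl (free_scale c x) = free_scale c (tensor_incl x)"
  "tensor_incl 0 = 0"
  by (simp_all add: tensor_incl_def lin_ext_linear)

lemma basis_vec_word_append:
  "basis_vec (Word (us @ vs)) = basis_vec (Word us) * (basis_vec (Word vs) :: tor_tensor)"
  by (simp add: basis_vec_def mult_single plus_free_word_def)

lemma basis_vec_word_Nil: "basis_vec (Word []) = (1 :: tor_tensor)"
  by (simp add: basis_vec_def zero_free_word_def flip: single_one)

lemma basis_vec_word: "basis_vec (Word us) = prod_list (map (\<lambda>a. tensor_incl (basis_vec a)) us)"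
proof (induction us)
  case (Cons a us)
  then show ?case
    using basis_vec_word_append[of "[a]" us] by (simp add: tensor_incl_def)
qed (simp add: basis_vec_word_Nil)

lemma abs_tor_env_add: "abs_tor_env (p + q) = abs_tor_env p + abs_tor_env q"
  and abs_tor_env_mult: "abs_tor_env (p * q) = abs_tor_env p * abs_tor_env q"
  and abs_tor_env_one: "abs_tor_env 1 = 1"
  and abs_tor_env_zero: "abs_tor_env 0 = 0"
  and abs_tor_env_scale: "abs_tor_env (free_scale c p) = env_scale c (abs_tor_env p)"
  and abs_tor_env_incl: "abs_tor_env (tensor_incl x) = env_incl x"
  by (simp_all add: plus_tor_env.abs_eq times_tor_env.abs_eq one_tor_env_def zero_tor_env_def
      env_scale.abs_eq env_incl.abs_eq)

lemma abs_tor_env_prod: "abs_tor_env (prod_list (map tensor_incl xs)) = prod_list (map env_incl xs)"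
  by (induction xs) (simp_all add: abs_tor_env_one abs_tor_env_mult abs_tor_env_incl)

lemma tor_env_induct [case_names zero word scale add]:
  assumes zero: "P 0" and word: "\<And>xs. P (prod_list (map env_incl xs))"
    and scale: "\<And>c u. P u \<Longrightarrow> P (env_scale c u)" and add: "\<And>u v. P u \<Longrightarrow> P v \<Longrightarrow> P (u + v)"
  shows "P (u :: tor_env)"
proof -
  have "P (abs_tor_env p)" for p
  proof (induction p rule: basis_induct)
    case (basis w)
    obtain us where "w = Word us" by (cases w)
    then have "abs_tor_env (basis_vec w) = prod_list (map env_incl (map basis_vec us))"
      using abs_tor_env_prod[of "map basis_vec us"] by (simp add: basis_vec_word comp_def)
    then show ?case using word[of "map basis_vec us"] by simp
  qed (simp_all add: assms abs_tor_env_zero abs_tor_env_add abs_tor_env_scale)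
  then show ?thesis by (metis tor_env.abs_induct)
qed

lemma env_incl_add: "env_incl (x + y) = env_incl x + env_incl y"
  and env_incl_scale: "env_incl (free_scale c x) = env_scale c (env_incl x)"
  and env_incl_zero: "env_incl 0 = 0"
  by (simp_all add: tensor_incl_linear abs_tor_env_add abs_tor_env_scale abs_tor_env_zero
      flip: abs_tor_env_incl)

lemma env_scale_mult_left: "env_scale c u * v = env_scale c (u * v)"
  and env_scale_mult_right: "u * env_scale c v = env_scale c (u * v)"
  by (transfer; simp add: env_cong_def env_ideal_zero flip: free_scale_mult_left free_scale_mult_right)+

lemma env_incl_commute: "env_incl x * env_incl y = env_incl y * env_incl x + env_incl (tor_bracket x y)"
  by (simp add: env_incl_bracket)

text \<open>This identity is the source of the recursion that defines the Harish-Chandra functional.\<close>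

lemma env_word_commute:
  "prod_list (map env_incl xs) * env_incl y = env_incl y * prod_list (map env_incl xs) +
     leibniz (\<lambda>x. tor_bracket x y) (\<lambda>ws. prod_list (map env_incl ws)) xs"
proof (induction xs)
  case (Cons x xs)
  have "prod_list (map env_incl (x # xs)) * env_incl y =
      env_incl x * (prod_list (map env_incl xs) * env_incl y)"
    by (simp add: mult.assoc)
  also have "\<dots> = (env_incl x * env_incl y) * prod_list (map env_incl xs) +
      env_incl x * leibniz (\<lambda>x. tor_bracket x y) (\<lambda>ws. prod_list (map env_incl ws)) xs"
    unfolding Cons.IH by (simp add: distrib_left mult.assoc)
  finally show ?case
    by (simp add: env_incl_commute[of x y] leibniz_mult_left distrib_right mult.assoc)
qed simp

locale env_functional =
  fixes phi :: "tor_env \<Rightarrow> complex"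
  assumes add: "phi (u + v) = phi u + phi v"
    and scale: "phi (env_scale c u) = c * phi u"
begin

lemma zero: "phi 0 = 0"
  using add[of 0 0] by simp

text \<open>\<open>U\<close> is spanned by \<open>1\<close>, \<open>\<TT>\<^sub>- U\<close> and \<open>U (\<TT>\<^sub>+ \<oplus> \<hh>)\<close>. By induction on the
  length of a word, its last letter is either absorbed into a scalar or moved to the front, at the
  cost of words that are shorter than the original one.\<close>

lemma eq_zero:
  assumes one: "phi 1 = 0"
    and minus: "\<And>y u. project is_minus y = y \<Longrightarrow> phi (env_incl y * u) = 0"
    and nonminus: "\<And>a. \<not> is_minus a \<Longrightarrow> \<exists>c. \<forall>u. phi (u * env_incl (basis_vec a)) = c * phi u"
  shows "phi u = 0"
proof (induction u rule: tor_env_induct)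
  case (word xs)
  show ?case
  proof (induction "length xs" arbitrary: xs)
    case 0
    then show ?case by (simp add: one)
  next
    case (Suc n)
    then obtain ys x where xs: "xs = ys @ [x]"
      by (cases xs rule: rev_cases) auto
    then have n: "n = length ys" using Suc.hyps(2) by simp
    have "phi (prod_list (map env_incl ys) * env_incl x) = 0"
    proof (induction x rule: basis_induct)
      case (basis a)
      show ?case
      proof (cases "is_minus a")
        case True
        have "phi (leibniz (\<lambda>x. tor_bracket x (basis_vec a)) (\<lambda>ws. prod_list (map env_incl ws)) ys) =
          leibniz (\<lambda>x. tor_bracket x (basis_vec a)) (\<lambda>ws. phi (prod_list (map env_incl ws))) ys"
          by (rule leibniz_additive[symmetric]) (simp_all add: add zero)
        also have "\<dots> = 0"
          by (rule leibniz_same_length_eq_zero) (simp add: Suc.hyps(1) n)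
        finally show ?thesis
          using minus[of "basis_vec a"] True by (simp add: env_word_commute add)
      next
        case False
        then show ?thesis using nonminus[OF False] Suc.hyps(1)[OF n] by auto
      qed
    qed (simp_all add: env_incl_add env_incl_scale env_incl_zero zero add scale distrib_left
        env_scale_mult_right)
    then show ?case by (simp add: xs)
  qed
qed (simp_all add: zero add scale)

text \<open>The textbook formula for \<open>e f\<^bsup>n+1\<^esup> v\<close>, where \<open>v\<close> is a highest weight vector of weight \<open>mu\<close>. Its
  coefficient vanishes for \<open>mu = n\<close>, which yields the singular vectors, and for no \<open>n\<close> if \<open>mu\<close> is not
  a natural number, which rules out local nilpotency.\<close>

lemma sl2_string:
  assumes ef: "tor_bracket e f = h" and hf: "tor_bracket h f = free_scale (- 2) f"
    and e: "\<And>u. phi (u * env_incl e) = 0" and h: "\<And>u. phi (u * env_incl h) = mu * phi u"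
  shows "phi (u * env_incl e * env_incl f ^ Suc n) =
    of_nat (Suc n) * (mu - of_nat n) * phi (u * env_incl f ^ n)"
proof -
  have hf_env: "env_incl h * env_incl f = env_incl f * env_incl h + env_scale (- 2) (env_incl f)"
    using env_incl_commute[of h f] by (simp only: hf env_incl_scale)
  have hn: "phi (u * env_incl h * env_incl f ^ n) = (mu - 2 * of_nat n) * phi (u * env_incl f ^ n)" for u n
  proof (induction n arbitrary: u)
    case (Suc n)
    have "u * env_incl h * env_incl f ^ Suc n =
        (u * env_incl f) * env_incl h * env_incl f ^ n + env_scale (- 2) (u * env_incl f ^ Suc n)"
      using hf_env
      by (simp add: mult.assoc left_diff_distrib right_diff_distrib env_scale_mult_left
          env_scale_mult_right flip: mult.assoc[of "env_incl h" "env_incl f"])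
    then have "phi (u * env_incl h * env_incl f ^ Suc n) =
        phi ((u * env_incl f) * env_incl h * env_incl f ^ n) - 2 * phi (u * env_incl f ^ Suc n)"
      by (simp only: add scale) simp
    then show ?case
      using Suc.IH[of "u * env_incl f"] by (simp add: mult.assoc) (simp add: algebra_simps)
  qed (simp add: h)
  show ?thesis
  proof (induction n arbitrary: u)
    case 0
    have "u * env_incl e * env_incl f ^ Suc 0 = (u * env_incl f) * env_incl e + u * env_incl h"
      using env_incl_commute[of e f] by (simp add: ef mult.assoc distrib_left)
    then show ?case by (simp add: add e h)
  next
    case (Suc n)
    have "u * env_incl e * env_incl f ^ Suc (Suc n) =
        (u * env_incl f) * env_incl e * env_incl f ^ Suc n + u * env_incl h * env_incl f ^ Suc n"
      using env_incl_commute[of e f]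
      by (simp add: ef mult.assoc distrib_left distrib_right
          flip: mult.assoc[of "env_incl e" "env_incl f"])
    then have "phi (u * env_incl e * env_incl f ^ Suc (Suc n)) =
        phi ((u * env_incl f) * env_incl e * env_incl f ^ Suc n) + phi (u * env_incl h * env_incl f ^ Suc n)"
      by (simp only: add)
    also have "\<dots> = of_nat (Suc n) * (mu - of_nat n) * phi (u * env_incl f ^ Suc n) +
        (mu - 2 * of_nat (Suc n)) * phi (u * env_incl f ^ Suc n)"
      unfolding Suc.IH hn by (simp add: mult.assoc)
    also have "\<dots> = of_nat (Suc (Suc n)) * (mu - of_nat (Suc n)) * phi (u * env_incl f ^ Suc n)"
      by (simp add: algebra_simps)
    finally show ?case .
  qed
qed

end

section \<open>The Harish-Chandra functional and singular vectors\<close>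

context highest_weight
begin

abbreviation hc :: "toroidal list \<Rightarrow> complex" where
  "hc xs \<equiv> hc_at (length xs) xs"

definition hc_tensor :: "tor_tensor \<Rightarrow> complex" where
  "hc_tensor = extend_linearly (\<lambda>w. hc (rev (map basis_vec (letters w))))"

lemma hc_tensor_word:
  "hc_tensor (basis_vec (Word us) * prod_list (map tensor_incl xs)) = hc (rev (map basis_vec us @ xs))"
proof (induction xs arbitrary: us)
  case Nil
  show ?case by (simp add: hc_tensor_def)
next
  case (Cons x xs)
  interpret ml: multilinear free_scale "hc_at (Suc (length xs + length us))"
    by (rule multilinear_hc_at)
  show ?case
  proof (induction x rule: basis_induct)
    case zero
    show ?case using ml.zero[of "rev xs" "rev (map basis_vec us)"]
      by (simp add: tensor_incl_linear hc_tensor_def)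
  next
    case (basis a)
    have "basis_vec (Word us) * tensor_incl (basis_vec a) = basis_vec (Word (us @ [a]))"
      by (simp add: basis_vec_word_append) (simp add: tensor_incl_def)
    then show ?case using Cons.IH[of "us @ [a]"] by (simp add: flip: mult.assoc)
  next
    case (scale c p)
    then show ?case using ml.scale[of "rev xs" c p "rev (map basis_vec us)"]
      by (simp add: tensor_incl_linear hc_tensor_def extend_linearly_scale
          flip: free_scale_mult_left free_scale_mult_right)
  next
    case (add p q)
    then show ?case using ml.add[of "rev xs" p q "rev (map basis_vec us)"]
      by (simp add: tensor_incl_linear hc_tensor_def extend_linearly_add distrib_left distrib_right)
  qed
qed

lemma hc_tensor_linear: "hc_tensor (p + q) = hc_tensor p + hc_tensor q"
  "hc_tensor (p - q) = hc_tensor p - hc_tensor q"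
  "hc_tensor (free_scale c p) = c * hc_tensor p" "hc_tensor 0 = 0"
  by (simp_all add: hc_tensor_def extend_linearly_add extend_linearly_diff extend_linearly_scale)

lemma hc_tensor_relation:
  "hc_tensor (a * (tensor_incl x * tensor_incl y - tensor_incl y * tensor_incl x
     - tensor_incl (tor_bracket x y)) * b) = 0"
proof (induction a rule: basis_induct)
  case (basis v)
  obtain us where v: "v = Word us" by (cases v)
  show ?case
  proof (induction b rule: basis_induct)
    case (basis w)
    obtain vs where w: "basis_vec w = prod_list (map tensor_incl (map basis_vec vs))"
      by (cases w) (simp add: basis_vec_word comp_def)
    have "hc_tensor (basis_vec v * (tensor_incl x * tensor_incl y - tensor_incl y * tensor_incl x
        - tensor_incl (tor_bracket x y)) * basis_vec w) =
      hc_tensor (basis_vec (Word us) * prod_list (map tensor_incl (x # y # map basis_vec vs))) -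
      hc_tensor (basis_vec (Word us) * prod_list (map tensor_incl (y # x # map basis_vec vs))) -
      hc_tensor (basis_vec (Word us) * prod_list (map tensor_incl (tor_bracket x y # map basis_vec vs)))"
      unfolding v w by (simp add: algebra_simps hc_tensor_linear)
    also have "\<dots> = 0"
      unfolding hc_tensor_word
      using hc_at_swap[of "Suc (length vs + length us)" "rev (map basis_vec vs)" y x "rev (map basis_vec us)"]
      by simp
    finally show ?case .
  qed (simp_all add: hc_tensor_linear distrib_left flip: free_scale_mult_right)
qed (simp_all add: hc_tensor_linear distrib_right flip: free_scale_mult_left)

lemma hc_tensor_env_ideal: "p \<in> env_ideal \<Longrightarrow> hc_tensor p = 0"
  unfolding env_ideal_def
  by (induction rule: free.span_induct_alt) (auto simp: hc_tensor_linear hc_tensor_relation)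

text \<open>The choice of a representative is harmless because \<^const>\<open>hc_tensor\<close> vanishes on \<^const>\<open>env_ideal\<close>.\<close>

definition hc_env :: "tor_env \<Rightarrow> complex" where
  "hc_env u = hc_tensor (rep_tor_env u)"

lemma hc_env_abs: "hc_env (abs_tor_env p) = hc_tensor p"
proof -
  have "env_cong p p" by (simp add: env_cong_def env_ideal_zero)
  then have "env_cong (rep_tor_env (abs_tor_env p)) p"
    by (rule Quotient_rep_abs[OF Quotient_tor_env])
  then have "hc_tensor (rep_tor_env (abs_tor_env p) - p) = 0"
    by (simp add: env_cong_def hc_tensor_env_ideal)
  then show ?thesis by (simp add: hc_env_def hc_tensor_linear)
qed

lemma hc_env_word: "hc_env (prod_list (map env_incl xs)) = hc (rev xs)"
  using hc_tensor_word[of "[]" xs] by (simp add: basis_vec_word_Nil hc_env_abs flip: abs_tor_env_prod)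

sublocale env_functional hc_env
proof
  fix u v :: tor_env and c
  obtain p q where "u = abs_tor_env p" "v = abs_tor_env q"
    by (induction u rule: tor_env.abs_induct, induction v rule: tor_env.abs_induct) blast
  then show "hc_env (u + v) = hc_env u + hc_env v" "hc_env (env_scale c u) = c * hc_env u"
    by (simp_all add: hc_env_abs hc_tensor_linear flip: abs_tor_env_add abs_tor_env_scale)
qed

lemma hc_env_one: "hc_env 1 = 1"
  using hc_env_word[of "[]"] by simp

lemma hc_env_nonminus:
  assumes "project is_minus x = 0"
  shows "hc_env (u * env_incl x) = lam (project is_cartan x) * hc_env u"
proof (induction u rule: tor_env_induct)
  case (word xs)
  then show ?case
    using hc_env_word[of "xs @ [x]"] by (simp add: hc_at_Cons_nonnegative[OF assms] hc_env_word)
qed (simp_all add: zero add scale distrib_left distrib_right env_scale_mult_left)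

lemma hc_env_minus:
  assumes "project is_minus y = y"
  shows "hc_env (env_incl y * u) = 0"
proof (induction u rule: tor_env_induct)
  case (word xs)
  show ?case
    using hc_env_word[of "y # xs"] assms
      hc_at_first_negative[OF bracket_project_minus, of y "Suc (length xs)" "rev xs"]
    by (simp add: project_cartan_minus lam_zero)
qed (simp_all add: zero add scale distrib_left distrib_right env_scale_mult_right)

lemma hc_env_tor_plus: "x \<in> tor_plus \<Longrightarrow> hc_env (u * env_incl x) = 0"
  by (simp add: hc_env_nonminus project_of_mem_tor_plus lam_zero)

lemma hc_env_cartan: "h \<in> cartan \<Longrightarrow> hc_env (u * env_incl h) = lam h * hc_env u"
  by (simp add: hc_env_nonminus project_of_mem_cartan)

end

lemma bracket_basis_cartan:
  assumes "is_cartan a" "is_minus b"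
  shows "\<exists>c. tor_bracket_basis a b = free_scale c (basis_vec b)"
proof (cases b)
  case (Loop x m n)
  have "\<exists>c. 0 = free_scale c (basis_vec b)" "\<exists>c. basis_vec b = free_scale c (basis_vec b)"
    "\<exists>c. free_scale k (basis_vec b) = free_scale c (basis_vec b)"
    "\<exists>c. - free_scale k (basis_vec b) = free_scale c (basis_vec b)" for k
    using free.scale_zero_left[of "basis_vec b"] free.scale_one[of "basis_vec b"]
      free.scale_minus_left[of k "basis_vec b"] by metis+
  with assms Loop show ?thesis
    by (cases a; cases x) (auto simp: loop_linear)
qed (use assms in auto)

context highest_weight
begin

text \<open>With \<open>e\<close> the positive and \<open>y\<close> the negative root vector of a simple root, and \<open>h\<close> its coroot, the
  vector \<open>y\<^bsup>n+1\<^esup> v\<^sub>\<lambda>\<close> is singular: it is an eigenvector of \<open>\<hh>\<close>, it is killed by \<open>e\<close> by the \<open>sl\<^sub>2\<close> formula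
  and by the span of the other vectors of \<open>\<TT>\<^sub>+\<close> because bracketing with \<open>y\<close> maps this span (the
  vectors with \<open>P\<close>) to itself: subtracting a simple root from another positive root never gives a
  negative root, zero or that simple root. So \<open>u \<mapsto> \<Phi>(u y\<^bsup>n+1\<^esup>)\<close> satisfies the hypotheses of
  \<open>eq_zero\<close>.\<close>

lemma hc_env_singular:
  fixes e y :: tor_basis and n :: nat
  defines "P \<equiv> \<lambda>a. \<not> is_minus a \<and> \<not> is_cartan a \<and> a \<noteq> e"
  assumes e: "\<not> is_minus e" "\<not> is_cartan e" and y: "is_minus y"
    and P: "\<And>a. P a \<Longrightarrow> project P (tor_bracket_basis a y) = tor_bracket_basis a y"
    and h: "tor_bracket_basis e y = h" "tor_bracket h (basis_vec y) = free_scale (- 2) (basis_vec y)"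
      "h \<in> cartan" "lam h = of_nat n"
  shows "hc_env (u * env_incl (basis_vec y) ^ Suc n) = 0"
proof -
  let ?Y = "env_incl (basis_vec y)"
  interpret phi: env_functional "\<lambda>u. hc_env (u * ?Y ^ Suc n)"
    by unfold_locales (simp_all only: distrib_right env_scale_mult_left add scale)
  have P_closed: "project P (tor_bracket x (basis_vec y)) = tor_bracket x (basis_vec y)"
    if "project P x = x" for x
  proof -
    have "project P (tor_bracket (project P x) (basis_vec y)) = tor_bracket (project P x) (basis_vec y)" for x
      by (induction x rule: basis_induct) (simp_all add: tor_bracket_linear project_linear P)
    from this[of x] show ?thesis using that by simp
  qed
  have P_zero: "hc_env (u * env_incl x * ?Y ^ k) = 0" if "project P x = x" for u x k
    using that
  proof (induction k arbitrary: u x)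
    case 0
    have "project is_minus x = 0" "project is_cartan x = 0"
      by (rule poly_mapping_eqI, subst 0[symmetric], simp add: lookup_project P_def)+
    then show ?case by (simp add: hc_env_nonminus lam_zero)
  next
    case (Suc k)
    have "u * env_incl x * ?Y ^ Suc k = (u * ?Y) * env_incl x * ?Y ^ k +
        u * env_incl (tor_bracket x (basis_vec y)) * ?Y ^ k"
      using env_incl_commute[of x "basis_vec y"]
      by (simp add: mult.assoc distrib_left distrib_right flip: mult.assoc[of "env_incl x" ?Y])
    then show ?case by (simp only: add Suc.IH[OF Suc.prems] Suc.IH[OF P_closed[OF Suc.prems]] add_0_left)
  qed
  have cartan_eigen: "\<exists>c. \<forall>u. hc_env (u * env_incl (basis_vec a) * ?Y ^ k) = c * hc_env (u * ?Y ^ k)"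
    if a: "is_cartan a" for a k
  proof (induction k)
    case 0
    have "\<not> is_minus a" using a minus_not_cartan by blast
    then show ?case by (auto simp: hc_env_nonminus)
  next
    case (Suc k)
    then obtain c where c: "\<And>u. hc_env (u * env_incl (basis_vec a) * ?Y ^ k) = c * hc_env (u * ?Y ^ k)"
      by blast
    obtain d where d: "tor_bracket_basis a y = free_scale d (basis_vec y)"
      using bracket_basis_cartan[OF a y] by blast
    have "hc_env (u * env_incl (basis_vec a) * ?Y ^ Suc k) = (c + d) * hc_env (u * ?Y ^ Suc k)" for u
    proof -
      have "u * env_incl (basis_vec a) * ?Y ^ Suc k =
          (u * ?Y) * env_incl (basis_vec a) * ?Y ^ k + env_scale d (u * ?Y ^ Suc k)"
        using env_incl_commute[of "basis_vec a" "basis_vec y"]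
        by (simp add: d env_incl_scale mult.assoc distrib_left distrib_right env_scale_mult_left
            env_scale_mult_right flip: mult.assoc[of "env_incl (basis_vec a)" ?Y])
      then show ?thesis
        by (simp only: add scale c) (simp add: mult.assoc distrib_right)
    qed
    then show ?case by blast
  qed
  show ?thesis
  proof (rule phi.eq_zero)
    show "hc_env (1 * ?Y ^ Suc n) = 0"
      using hc_env_minus[of "basis_vec y" "?Y ^ n"] y by simp
    show "hc_env (env_incl x * u * ?Y ^ Suc n) = 0" if "project is_minus x = x" for x u
      using hc_env_minus[OF that] by (simp only: mult.assoc)
    show "\<exists>c. \<forall>u. hc_env (u * env_incl (basis_vec a) * ?Y ^ Suc n) = c * hc_env (u * ?Y ^ Suc n)"
      if a: "\<not> is_minus a" for a
    proof -
      consider "is_cartan a" | "a = e" | "P a" using a by (auto simp: P_def)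
      then show ?thesis
      proof cases
        case 1
        then show ?thesis by (rule cartan_eigen)
      next
        case 2
        have "hc_env (u * env_incl (basis_vec e) * ?Y ^ Suc n) = 0" for u
          using sl2_string[of "basis_vec e" "basis_vec y" h "of_nat n" u n] h e
          by (simp add: hc_env_nonminus hc_env_cartan lam_zero)
        then show ?thesis unfolding 2 by (intro exI[of _ 0]) simp
      next
        case 3
        then show ?thesis using P_zero[where x = "basis_vec a" and k = "Suc n"] by (intro exI[of _ 0]) simp
      qed
    qed
  qed
qed

lemma coroot_mem_cartan: "tor_h 0 0 \<in> cartan" "basis_vec C1 \<in> cartan" "basis_vec C2 \<in> cartan"
  by (auto simp: cartan_def intro!: free.span_base)

text \<open>The roots of \<open>t\<^sub>2\<close>-degree \<open>0\<close> are those of the affine Lie algebra. Its simple roots are \<open>\<alpha>\<^sub>1\<close> with root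
  vectors \<open>e(0,0)\<close>, \<open>f(0,0)\<close>, and \<open>\<alpha>\<^sub>0\<close> with root vectors \<open>f(1,0)\<close>, \<open>e(-1,0)\<close>.\<close>

lemma hc_env_singular_f:
  assumes "lam coroot1 = of_nat n"
  shows "hc_env (u * env_incl (tor_f 0 0) ^ Suc n) = 0"
  unfolding tor_f_def
proof (rule hc_env_singular[where e = "Loop Sl2_E 0 0" and h = coroot1])
  fix a assume a: "\<not> is_minus a \<and> \<not> is_cartan a \<and> a \<noteq> Loop Sl2_E 0 0"
  then obtain x m n where "a = Loop x m n" by (cases a) auto
  with a show "project (\<lambda>a. \<not> is_minus a \<and> \<not> is_cartan a \<and> a \<noteq> Loop Sl2_E 0 0)
      (tor_bracket_basis a (Loop Sl2_F 0 0)) = tor_bracket_basis a (Loop Sl2_F 0 0)"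
    by (cases x) (auto simp: loop_linear project_linear)
qed (use assms coroot_mem_cartan in \<open>auto simp: coroot1_def tor_h_def loop_linear\<close>)

lemma hc_env_singular_e:
  assumes "lam coroot0 = of_nat n"
  shows "hc_env (u * env_incl (tor_e (- 1) 0) ^ Suc n) = 0"
  unfolding tor_e_def
proof (rule hc_env_singular[where e = "Loop Sl2_F 1 0" and h = coroot0])
  fix a assume a: "\<not> is_minus a \<and> \<not> is_cartan a \<and> a \<noteq> Loop Sl2_F 1 0"
  then obtain x m n where "a = Loop x m n" by (cases a) auto
  with a show "project (\<lambda>a. \<not> is_minus a \<and> \<not> is_cartan a \<and> a \<noteq> Loop Sl2_F 1 0)
      (tor_bracket_basis a (Loop Sl2_E (- 1) 0)) = tor_bracket_basis a (Loop Sl2_E (- 1) 0)"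
    by (cases x) (auto simp: loop_linear project_linear)
next
  show "tor_bracket coroot0 (basis_vec (Loop Sl2_E (- 1) 0)) =
      free_scale (- 2) (basis_vec (Loop Sl2_E (- 1) 0))"
    by (simp add: coroot0_def tor_h_def tor_bracket_linear)
  show "coroot0 \<in> cartan"
    using coroot_mem_cartan free.span_diff by (simp add: coroot0_def cartan_def)
qed (use assms in \<open>auto simp: coroot0_def tor_h_def loop_linear\<close>)

lemma hc_env_string_nonzero:
  assumes h: "h = tor_h 0 0 + (free_scale (of_int m) (basis_vec C1) + basis_vec C2)"
    and "\<And>n :: nat. lam h \<noteq> of_nat n"
  shows "hc_env (env_incl (tor_e m 1) ^ n * env_incl (tor_f (- m) (- 1)) ^ n) \<noteq> 0"
proof (induction n)
  case 0
  then show ?case by (simp add: hc_env_one)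
next
  case (Suc n)
  have cartan: "h \<in> cartan"
    using coroot_mem_cartan by (simp add: h cartan_def free.span_add free.span_scale)
  have ef: "tor_bracket (tor_e m 1) (tor_f (- m) (- 1)) = h"
    by (simp add: h tor_e_def tor_f_def tor_h_def loop_linear)
  have hf: "tor_bracket h (tor_f (- m) (- 1)) = free_scale (- 2) (tor_f (- m) (- 1))"
    by (simp add: h tor_f_def tor_h_def tor_bracket_linear tor_bracket_central)
  have e: "hc_env (u * env_incl (tor_e m 1)) = 0" for u
    by (simp add: hc_env_nonminus tor_e_def lam_zero)
  have "hc_env (env_incl (tor_e m 1) ^ n * env_incl (tor_e m 1) * env_incl (tor_f (- m) (- 1)) ^ Suc n) =
    of_nat (Suc n) * (lam h - of_nat n) *
      hc_env (env_incl (tor_e m 1) ^ n * env_incl (tor_f (- m) (- 1)) ^ n)"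
    by (rule sl2_string[OF ef hf e hc_env_cartan[OF cartan]])
  then show ?case
    using Suc assms(2)[of n]
    by (simp add: power_Suc2[of "env_incl (tor_e m 1)"] del: of_nat_Suc power_Suc)
qed

end


section \<open>Representatives in the quotients\<close>

lemma mem_coset_pre_verma: "p \<in> R +>\<^bsub>pre_verma\<^esub> q \<longleftrightarrow> (\<exists>r\<in>R. p = r + q)"
  by (auto simp: a_r_coset_def r_coset_def pre_verma_def)

lemma mem_set_add_pre_verma: "p \<in> A <+>\<^bsub>pre_verma\<^esub> B \<longleftrightarrow> (\<exists>a\<in>A. \<exists>b\<in>B. p = a + b)"
  by (auto simp: set_add_def set_mult_def pre_verma_def)

lemma mem_act_verma: "p \<in> act (verma lam) w A \<longleftrightarrow>
    (\<exists>q\<in>A. \<exists>r\<in>verma_rel lam. p = r + act pre_verma w q)"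
  by (auto simp: verma_def quot_module_def mem_coset_pre_verma)

lemma mem_coset_verma: "X \<in> S +>\<^bsub>verma lam\<^esub> B \<longleftrightarrow> (\<exists>A\<in>S. X = A <+>\<^bsub>pre_verma\<^esub> B)"
  by (auto simp: a_r_coset_def r_coset_def verma_def quot_module_def)

lemma mem_set_add_verma: "X \<in> S <+>\<^bsub>verma lam\<^esub> T \<longleftrightarrow> (\<exists>A\<in>S. \<exists>B\<in>T. X = A <+>\<^bsub>pre_verma\<^esub> B)"
  by (auto simp: set_add_def set_mult_def verma_def quot_module_def)

context highest_weight
begin

text \<open>The functional \<open>u v\<^sub>\<lambda> \<mapsto> \<Phi>(b u)\<close> on the Verma module, before passing to the quotient.\<close>

definition pairing :: "tor_env \<Rightarrow> pre_verma \<Rightarrow> complex" where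
  "pairing b = extend_linearly (\<lambda>(u, z). z * hc_env (b * u))"

lemma pairing_linear: "pairing b (p + q) = pairing b p + pairing b q"
  "pairing b (p - q) = pairing b p - pairing b q"
  "pairing b (free_scale c p) = c * pairing b p" "pairing b 0 = 0"
  "pairing b (basis_vec (u, z)) = z * hc_env (b * u)"
  by (simp_all add: pairing_def extend_linearly_add extend_linearly_diff extend_linearly_scale)

lemma pairing_verma_rel: "r \<in> verma_rel lam \<Longrightarrow> pairing b r = 0"
  unfolding verma_rel_def
proof (induction rule: free.span_induct_alt)
  case (step c x y)
  have "pairing b x = 0"
    using step(1) by (auto simp: pairing_linear distrib_left distrib_right add scale env_scale_mult_right
        hc_env_tor_plus hc_env_cartan zero simp flip: mult.assoc)
  then show ?case using step by (simp add: pairing_linear)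
qed (simp add: pairing_linear)

lemma pairing_act: "pairing b (act pre_verma w p) = pairing (b * w) p"
proof (induction p rule: basis_induct)
  case (basis a)
  show ?case by (cases a) (simp add: pre_verma_def pairing_linear mult.assoc)
qed (simp_all add: pre_verma_def pairing_linear lin_ext_linear)

text \<open>Elements of the Verma module are cosets, and the operations on cosets are unions over all
  representatives. Instead of showing that these operations are well defined, the proofs track the one
  property that is needed: all members of \<open>A\<close> have the same pairings as \<open>u v\<^sub>\<lambda>\<close>.\<close>

definition represents :: "pre_verma set \<Rightarrow> tor_env \<Rightarrow> bool" where
  "represents A u \<longleftrightarrow> A \<noteq> {} \<and> (\<forall>p\<in>A. \<forall>b. pairing b p = hc_env (b * u))"

lemma verma_rel_zero: "0 \<in> verma_rel lam"
  by (simp add: verma_rel_def free.span_zero)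

lemma represents_verma_vec: "represents (verma_vec lam) 1"
  using verma_rel_zero
  by (auto simp: represents_def verma_vec_def mem_coset_pre_verma pairing_linear pairing_verma_rel set_eq_iff)

lemma represents_act: "represents A u \<Longrightarrow> represents (act (verma lam) w A) (w * u)"
  using verma_rel_zero unfolding represents_def
  by (fastforce simp: mem_act_verma pairing_linear pairing_verma_rel pairing_act set_eq_iff mult.assoc)

lemma represents_act_pow: "represents A u \<Longrightarrow> represents ((act (verma lam) w ^^ n) A) (w ^ n * u)"
  by (induction n) (simp_all add: represents_act mult.assoc)

lemma represents_add: "represents A u \<Longrightarrow> represents B v \<Longrightarrow> represents (A <+>\<^bsub>pre_verma\<^esub> B) (u + v)"
  unfolding represents_def
  by (fastforce simp: mem_set_add_pre_verma pairing_linear distrib_left add set_eq_iff)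

lemma represents_zero_verma_sub:
  assumes "\<And>u. hc_env (u * env_incl y ^ k) = 0" and "A \<in> verma_sub lam y k"
  shows "represents A 0"
proof -
  obtain u where "A = act (verma lam) u ((act (verma lam) (env_incl y) ^^ k) (verma_vec lam))"
    using assms(2) by (auto simp: verma_sub_def)
  then have "represents A (u * (env_incl y ^ k * 1))"
    by (simp only: represents_act represents_act_pow represents_verma_vec)
  then show ?thesis
    using assms(1) by (simp add: represents_def zero flip: mult.assoc)
qed

end

lemma verma_vec_mem_carrier: "verma_vec lam \<in> carrier (verma lam)"
  by (auto simp: verma_vec_def verma_def quot_module_def A_RCOSETS_def RCOSETS_def a_r_coset_def pre_verma_def)

lemma coset_mem_carrier_quot_module:
  "v \<in> carrier M \<Longrightarrow> S +>\<^bsub>M\<^esub> v \<in> carrier (quot_module M S)"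
  by (auto simp: quot_module_def A_RCOSETS_def RCOSETS_def a_r_coset_def)

text \<open>An element of \<open>W(\<lambda>)\<close> is a coset whose members are cosets. Iterating \<open>f\<close> on the coset of \<open>v\<^sub>\<lambda>\<close> always
  leaves a member that represents \<open>f\<^sup>n\<close>. If the iteration ends in the zero coset \<open>S\<close>, that member also
  represents \<open>0\<close>.\<close>

lemma (in highest_weight) locally_nilpotent_imp_hc_env_zero:
  assumes S: "S \<noteq> {}" "\<And>A. A \<in> S \<Longrightarrow> represents A 0"
    and nil: "locally_nilpotent (quot_module (verma lam) S) f"
  shows "\<exists>N. \<forall>b. hc_env (b * env_incl f ^ N) = 0"
proof -
  let ?W = "quot_module (verma lam) S"
  let ?v = "S +>\<^bsub>verma lam\<^esub> verma_vec lam"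
  obtain N where N: "(act ?W (env_incl f) ^^ N) ?v = S"
    using nil coset_mem_carrier_quot_module[OF verma_vec_mem_carrier]
    by (fastforce simp: locally_nilpotent_def quot_module_def)
  obtain A where A: "A \<in> S" using S(1) by blast
  have "\<exists>X \<in> (act ?W (env_incl f) ^^ n) ?v. represents X (env_incl f ^ n)" for n
  proof (induction n)
    case 0
    have "A <+>\<^bsub>pre_verma\<^esub> verma_vec lam \<in> ?v" using A by (auto simp: mem_coset_verma)
    then show ?case using represents_add[OF S(2)[OF A] represents_verma_vec] by auto
  next
    case (Suc n)
    then obtain X where X: "X \<in> (act ?W (env_incl f) ^^ n) ?v" "represents X (env_incl f ^ n)" by blast
    let ?Y = "A <+>\<^bsub>pre_verma\<^esub> act (verma lam) (env_incl f) X"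
    have "represents ?Y (env_incl f ^ Suc n)"
      using represents_add[OF S(2)[OF A] represents_act[OF X(2), of "env_incl f"]] by simp
    moreover have "?Y \<in> act ?W (env_incl f) ((act ?W (env_incl f) ^^ n) ?v)"
      using X(1) A by (auto simp: quot_module_def mem_coset_verma[unfolded quot_module_def])
    ultimately show ?case by auto
  qed
  then obtain X where X: "X \<in> S" "represents X (env_incl f ^ N)" using N by blast
  then obtain p where "p \<in> X" by (auto simp: represents_def)
  then have "hc_env (b * env_incl f ^ N) = hc_env (b * 0)" for b
    using X(2) S(2)[OF X(1)] unfolding represents_def by metis
  then show ?thesis by (auto simp: zero)
qed

theorem proposition3p3:
  fixes lam :: "toroidal \<Rightarrow> complex" and n0 n1 :: nat and k1 :: real
  assumes "lam \<in> cartan_dual"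
    and "lam coroot0 = of_nat n0"
    and "lam coroot1 = of_nat n1"
    and "lam (basis_vec C1) = complex_of_real k1"
    and "k1 > 0"
    and "lam (basis_vec C2) = 0"
  shows "\<not> integrable_module (weyl_module lam n0 n1)"
proof
  assume integrable: "integrable_module (weyl_module lam n0 n1)"
  interpret highest_weight lam by unfold_locales (rule assms(1))
  obtain j :: nat where "real n1 / k1 < real j" using reals_Archimedean2 by blast
  then have j: "real n1 < real j * k1" using assms(5) by (simp add: field_simps)
  \<comment> \<open>a degree for which the coroot of \<open>e(m,1)\<close> takes a negative value at \<open>\<lambda>\<close>\<close>
  define m where "m = - int j"
  define h where "h = tor_h 0 0 + (free_scale (of_int m) (basis_vec C1) + basis_vec C2)"
  have closed: "x + y \<in> cartan" "free_scale c x \<in> cartan" if "x \<in> cartan" "y \<in> cartan" for x y c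
    using that by (simp_all add: cartan_def free.span_add free.span_scale)
  have "lam h = lam coroot1 + (of_int m * lam (basis_vec C1) + lam (basis_vec C2))"
    using coroot_mem_cartan by (simp add: h_def coroot1_def lam_add lam_scale closed)
  also have "\<dots> = complex_of_real (real n1 - real j * k1)"
    by (simp add: assms(3,4,6) m_def)
  finally have "lam h = complex_of_real (real n1 - real j * k1)" .
  then have "lam h \<noteq> of_nat n" for n
    using j of_real_eq_iff[of "real n1 - real j * k1" "real n", where 'a = complex] by simp
  note nonzero = hc_env_string_nonzero[OF h_def this]

  let ?SE = "verma_sub lam (tor_e (- 1) 0) (n0 + 1)" and ?SF = "verma_sub lam (tor_f 0 0) (n1 + 1)"
  let ?S = "?SE <+>\<^bsub>verma lam\<^esub> ?SF"
  have "0 \<in> env_minus" by (simp add: env_minus_def env.span_zero)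
  then have "?S \<noteq> {}"
    by (auto simp: verma_sub_def set_eq_iff mem_set_add_verma)
  moreover have "represents A 0" if A: "A \<in> ?S" for A
  proof -
    obtain B C where "A = B <+>\<^bsub>pre_verma\<^esub> C" "B \<in> ?SE" "C \<in> ?SF"
      using A unfolding mem_set_add_verma by blast
    moreover have "represents B 0" "represents C 0"
      using hc_env_singular_e[OF assms(2)] hc_env_singular_f[OF assms(3)] calculation
      by (auto intro: represents_zero_verma_sub simp del: power_Suc simp flip: Suc_eq_plus1)
    ultimately show ?thesis using represents_add[of B 0 C 0] by simp
  qed
  moreover have "locally_nilpotent (quot_module (verma lam) ?S) (tor_f (- m) (- 1))"
    using integrable by (simp add: integrable_module_def weyl_module_def)
  ultimately obtain N where "hc_env (b * env_incl (tor_f (- m) (- 1)) ^ N) = 0" for b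
    using locally_nilpotent_imp_hc_env_zero by blast
  then show False using nonzero by blast
qed

end
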